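(* Under Assumption A (stated in the context), the following hold. (i) For all $\mathcal A\in\mathbb W$ the Hamiltonian satisfies $$H_{\mathcal A}(X,P)=\sup_{\alpha\in\mathbb A_{\mathcal A}}\big\{\langle b_{\mathcal A}(X,\alpha),P\rangle_{L^2(\mathcal A)}-L_{\mathcal A}(X,\alpha)\big\}\quad\text{for }X,P\in L^2(\mathcal A)^d_{sa}.$$ (ii) $(H_{\mathcal A})_{\mathcal A\in\mathbb W}$ is a tracial $W^*$-function (in both variables) which is $E$-convex in the second variable: $P\mapsto H_{\mathcal A}(X,P)$ is convex, and for every tracial $W^*$-embedding $\iota:\mathcal A\to\mathcal B$ with adjoint $E$, $H_{\mathcal A}(X,EP)\le H_{\mathcal B}(\iota X,P)$ for all $X\in L^2(\mathcal A)^d_{sa}$, $P\in L^2(\mathcal B)^d_{sa}$. (iii) $H_{\mathcal A}$ is uniformly continuous on bounded sets. Also, for any $X,Y\in L^2(\mathcal A)^d_{sa}$ and $\gamma>1$, $$H_{\mathcal A}\big(X,\gamma(X-Y)\big)-H_{\mathcal A}\big(Y,\gamma(X-Y)\big)\ge-\Big(\frac{2\bar C+C_2^2}{2}\,\gamma\,\|X-Y\|^2_{L^2(\mathcal A)}+\frac1{2\gamma}\Big).$$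
   Context: **Algebras.** Fix $d\ge1$. A tracial $W^*$-algebra $\mathcal A=(A,\tau)$ is a von Neumann algebra with a faithful normal tracial state; $\mathbb W$ is a set of representatives of the isomorphism classes of tracial $W^*$-algebras with separable predual. $L^2(\mathcal A)$ is the completion of $A$ for $\langle X,Y\rangle_{L^2(\mathcal A)}=\tau(X^*Y)$; for $d$-tuples $\langle X,Y\rangle_{L^2(\mathcal A)}=\sum_j\tau((X^j)^*Y^j)$. $L^2(\mathcal A)^d_{sa}$ is the set of $d$-tuples of self-adjoint elements of $L^2(\mathcal A)$. A tracial $W^*$-embedding $\iota:\mathcal A\to\mathcal B$ is a unital trace-preserving $*$-homomorphism, extended to an isometry $L^2(\mathcal A)^d\to L^2(\mathcal B)^d$, with adjoint (conditional expectation) $E$; every $\iota:\mathcal A\to\mathcal B$ below is one. A tracial $W^*$-function is a family $f_{\mathcal A}:L^2(\mathcal A)^d_{sa}\to(-\infty,+\infty]$, $\mathcal A\in\mathbb W$, with $f_{\mathcal A}=f_{\mathcal B}\circ\iota$ for all $\iota:\mathcal A\to\mathcal B$ (similarly for several variables: $f_{\mathcal A}(X,P)=f_{\mathcal B}(\iota X,\iota P)$). **Assumption A.** *(Controls)* $\mathbb A_{\mathcal A}\subset L^2(\mathcal A)^d_{sa}$ is closed, convex, contains $0$, and for every $\iota:\mathcal A\to\mathcal B$ with adjoint $E$, $\iota\,\mathbb A_{\mathcal A}\subset\mathbb A_{\mathcal B}$ and $E\,\mathbb A_{\mathcal B}\subset\mathbb A_{\mathcal A}$. *(Drift)* $b_{\mathcal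 A}:L^2(\mathcal A)^d_{sa}\times\mathbb A_{\mathcal A}\to L^2(\mathcal A)^d_{sa}$ satisfies: (a) $\iota\,b_{\mathcal A}(X,\alpha)=b_{\mathcal B}(\iota X,\iota\alpha)$ for all $\iota:\mathcal A\to\mathcal B$; (b) $\alpha\mapsto b_{\mathcal A}(X,\alpha)$ is affine and $b_{\mathcal A}(X,E\alpha)=E\,b_{\mathcal B}(\iota X,\alpha)$ for $\alpha\in\mathbb A_{\mathcal B}$; (c) for each $M>0$ there is a modulus of continuity $\omega_M$ with $\|b_{\mathcal A}(X,\alpha)-b_{\mathcal A}(Y,\beta)\|^2_{L^2(\mathcal A)}\le\omega_M(\|X-Y\|^2_{L^2(\mathcal A)}+\|\alpha-\beta\|^2_{L^2(\mathcal A)})$ whenever $X,Y,\alpha,\beta$ have $L^2$-norm $\le M$, uniformly in $\mathcal A$; (d) there is $\bar C>0$ with $\|b_{\mathcal A}(X_1,\alpha)-b_{\mathcal A}(X_2,\alpha)\|_{L^2(\mathcal A)}\le\bar C\|X_1-X_2\|_{L^2(\mathcal A)}$ for all $\mathcal A$, $X_1,X_2,\alpha$. *(Costs)* $L_{\mathcal A}:L^2(\mathcal A)^d_{sa}\times\mathbb A_{\mathcal A}\to\mathbb R$ and $g_{\mathcal A}:L^2(\mathcal A)^d_{sa}\to\mathbb R$ satisfy: (a) both are tracial $W^*$-functions (so $L_{\mathcal B}(\iota X,\iota\alpha)=L_{\mathcal A}(X,\alpha)$); (b) $\alpha\mapsto L_{\mathcal A}(X,\alpha)$ is convex and $L_{\mathcal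 A}(X,E\alpha)\le L_{\mathcal B}(\iota X,\alpha)$ for $\alpha\in\mathbb A_{\mathcal B}$; (c) $L$ is uniformly continuous on bounded sets, uniformly in $\mathcal A$; (d) there are $C_1,C_2>0$ with $-C_1+\frac1{C_1}\|\alpha\|^2_{L^2(\mathcal A)}\le L_{\mathcal A}(X,\alpha)\le C_1(1+\|X\|_{L^2(\mathcal A)}+\|\alpha\|^2_{L^2(\mathcal A)})$, $-C_1\le g_{\mathcal A}(X)\le C_1(1+\|X\|_{L^2(\mathcal A)})$, $|L_{\mathcal A}(X_1,\alpha)-L_{\mathcal A}(X_2,\alpha)|\le C_2\|X_1-X_2\|_{L^2(\mathcal A)}$ and $|g_{\mathcal A}(X_1)-g_{\mathcal A}(X_2)|\le C_2\|X_1-X_2\|_{L^2(\mathcal A)}$. The constants $\bar C$, $C_2$ in the claim are these. **Hamiltonian.** $H_{\mathcal A}(X,P)=\sup_{\iota:\mathcal A\to\mathcal B\in\mathbb W}\sup_{\alpha\in\mathbb A_{\mathcal B}}\{\langle b_{\mathcal B}(\iota X,\alpha),\iota P\rangle_{L^2(\mathcal B)}-L_{\mathcal B}(\iota X,\alpha)\}$ for $X,P\in L^2(\mathcal A)^d_{sa}$. *)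

theory Defs
  imports "HOL-Analysis.Analysis"
begin

section \<open>The Hilbert space of square-summable complex sequences\<close>

typedef ell2 = "{f :: nat \<Rightarrow> complex. summable (\<lambda>n. (cmod (f n))\<^sup>2)}"
  morphisms coord Abs_ell2
  by (rule exI[of _ "\<lambda>_. 0"]) simp

lemma summable_coord: "summable (\<lambda>n. (cmod (coord x n))\<^sup>2)"
  using coord[of x] by simp

lemma ell2_eqI: "(\<And>n. coord x n = coord y n) \<Longrightarrow> x = y"
  by (metis coord_inject ext)

lemma square_summable_add:
  fixes f g :: "nat \<Rightarrow> complex"
  assumes "summable (\<lambda>n. (cmod (f n))\<^sup>2)" "summable (\<lambda>n. (cmod (g n))\<^sup>2)"
  shows "summable (\<lambda>n. (cmod (f n + g n))\<^sup>2)"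
proof (rule summable_comparison_test)
  show "summable (\<lambda>n. 2 * (cmod (f n))\<^sup>2 + 2 * (cmod (g n))\<^sup>2)"
    using assms by (intro summable_add summable_mult)
  have "(cmod (f n + g n))\<^sup>2 \<le> 2 * (cmod (f n))\<^sup>2 + 2 * (cmod (g n))\<^sup>2" for n
  proof -
    have "(cmod (f n + g n))\<^sup>2 \<le> (cmod (f n) + cmod (g n))\<^sup>2"
      by (intro power_mono norm_triangle_ineq) auto
    moreover have "0 \<le> (cmod (f n) - cmod (g n))\<^sup>2" by simp
    ultimately show ?thesis by (simp add: power2_eq_square algebra_simps)
  qed
  then show "\<exists>N. \<forall>n\<ge>N. norm ((cmod (f n + g n))\<^sup>2) \<le> 2 * (cmod (f n))\<^sup>2 + 2 * (cmod (g n))\<^sup>2"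
    by auto
qed

lemma square_summable_mult:
  fixes f :: "nat \<Rightarrow> complex"
  assumes "summable (\<lambda>n. (cmod (f n))\<^sup>2)"
  shows "summable (\<lambda>n. (cmod (c * f n))\<^sup>2)"
  using assms by (simp add: norm_mult power_mult_distrib summable_mult)

lemma summable_cinner: "summable (\<lambda>n. cnj (coord x n) * coord y n)"
proof (rule summable_comparison_test)
  show "summable (\<lambda>n. (cmod (coord x n))\<^sup>2 + (cmod (coord y n))\<^sup>2)"
    by (intro summable_add summable_coord)
  have "norm (cnj (coord x n) * coord y n) \<le> (cmod (coord x n))\<^sup>2 + (cmod (coord y n))\<^sup>2" for n
  proof -
    have "2 * cmod (coord x n) * cmod (coord y n) \<le> (cmod (coord x n))\<^sup>2 + (cmod (coord y n))\<^sup>2"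
      by (rule sum_squares_bound)
    moreover have "0 \<le> cmod (coord x n) * cmod (coord y n)" by simp
    moreover have "norm (cnj (coord x n) * coord y n) = cmod (coord x n) * cmod (coord y n)"
      by (simp add: norm_mult)
    ultimately show ?thesis by linarith
  qed
  then show "\<exists>N. \<forall>n\<ge>N. norm (cnj (coord x n) * coord y n)
      \<le> (cmod (coord x n))\<^sup>2 + (cmod (coord y n))\<^sup>2" by auto
qed

definition cinner :: "ell2 \<Rightarrow> ell2 \<Rightarrow> complex" where
  "cinner x y = (\<Sum>n. cnj (coord x n) * coord y n)"

instantiation ell2 :: real_inner
begin

definition "0 = Abs_ell2 (\<lambda>_. 0)"
definition "x + y = Abs_ell2 (\<lambda>n. coord x n + coord y n)"
definition "- x = Abs_ell2 (\<lambda>n. - coord x n)"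
definition "x - y = Abs_ell2 (\<lambda>n. coord x n - coord y n)"
definition "r *\<^sub>R x = Abs_ell2 (\<lambda>n. r *\<^sub>R coord x n)"
definition inner_ell2_def: "inner x y = Re (cinner x y)"
definition norm_ell2_def: "norm (x::ell2) = sqrt (inner x x)"
definition sgn_ell2_def: "sgn (x::ell2) = inverse (norm x) *\<^sub>R x"
definition dist_ell2_def: "dist (x::ell2) y = norm (x - y)"
definition uniformity_ell2_def:
  "(uniformity :: (ell2 \<times> ell2) filter) = (INF e\<in>{0 <..}. principal {(x, y). dist x y < e})"
definition open_ell2_def:
  "open (U :: ell2 set) \<longleftrightarrow> (\<forall>x\<in>U. eventually (\<lambda>(x', y). x' = x \<longrightarrow> y \<in> U) uniformity)"

lemma coord_zero: "coord 0 n = 0"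
  by (simp add: zero_ell2_def Abs_ell2_inverse)

lemma coord_add: "coord (x + y) n = coord x n + coord y n"
  using square_summable_add[OF summable_coord[of x] summable_coord[of y]]
  by (simp add: plus_ell2_def Abs_ell2_inverse)

lemma coord_uminus: "coord (- x) n = - coord x n"
  using summable_coord[of x] by (simp add: uminus_ell2_def Abs_ell2_inverse)

lemma coord_diff: "coord (x - y) n = coord x n - coord y n"
  using square_summable_add[OF summable_coord[of x] summable_coord[of "- y"]]
  by (simp add: minus_ell2_def coord_uminus Abs_ell2_inverse)

lemma coord_scaleR: "coord (r *\<^sub>R x) n = r *\<^sub>R coord x n"
  using square_summable_mult[OF summable_coord[of x], of "of_real r"]
  by (simp add: scaleR_ell2_def scaleR_conv_of_real Abs_ell2_inverse)

instance
proof
  fix x y z :: ell2 and a b :: real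
  show "x + y + z = x + (y + z)" "x + y = y + x" "0 + x = x" "- x + x = 0" "x - y = x + - y"
    "a *\<^sub>R (x + y) = a *\<^sub>R x + a *\<^sub>R y" "(a + b) *\<^sub>R x = a *\<^sub>R x + b *\<^sub>R x"
    "a *\<^sub>R b *\<^sub>R x = (a * b) *\<^sub>R x" "1 *\<^sub>R x = x"
    by (rule ell2_eqI,
        simp add: coord_add coord_zero coord_uminus coord_diff coord_scaleR scaleR_conv_of_real
          algebra_simps)+
  show "sgn x = inverse (norm x) *\<^sub>R x" by (rule sgn_ell2_def)
  show "dist x y = norm (x - y)" by (rule dist_ell2_def)
  show "uniformity = (INF e\<in>{0 <..}. principal {(x, y :: ell2). dist x y < e})"
    by (rule uniformity_ell2_def)
  show "open U \<longleftrightarrow> (\<forall>x\<in>U. eventually (\<lambda>(x', y). x' = x \<longrightarrow> y \<in> U) uniformity)" for U :: "ell2 set"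
    by (rule open_ell2_def)
  show "norm x = sqrt (inner x x)" by (rule norm_ell2_def)
  have inner_suminf: "inner u v = (\<Sum>n. Re (cnj (coord u n) * coord v n))" for u v :: ell2
    unfolding inner_ell2_def cinner_def by (rule Re_suminf[OF summable_cinner])
  note summ = summable_Re[OF summable_cinner]
  show "inner x y = inner y x"
    unfolding inner_suminf by (simp add: mult.commute)
  have "inner x z + inner y z
      = (\<Sum>n. Re (cnj (coord x n) * coord z n) + Re (cnj (coord y n) * coord z n))"
    unfolding inner_suminf by (rule suminf_add[OF summ summ])
  also have "\<dots> = inner (x + y) z"
    unfolding inner_suminf by (simp add: coord_add distrib_right)
  finally show "inner (x + y) z = inner x z + inner y z" by (rule sym)
  have "a * inner x y = (\<Sum>n. a * Re (cnj (coord x n) * coord y n))"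
    unfolding inner_suminf by (rule suminf_mult[OF summ, symmetric])
  also have "\<dots> = inner (a *\<^sub>R x) y"
    unfolding inner_suminf by (simp add: coord_scaleR distrib_left)
  finally show "inner (a *\<^sub>R x) y = a * inner x y" by (rule sym)
  have "Re (cnj (coord x n) * coord x n) = (cmod (coord x n))\<^sup>2" for n
    unfolding cmod_power2 by (simp add: power2_eq_square)
  then have norm_suminf: "inner x x = (\<Sum>n. (cmod (coord x n))\<^sup>2)"
    unfolding inner_suminf by simp
  show "0 \<le> inner x x"
    unfolding norm_suminf by (rule suminf_nonneg[OF summable_coord]) simp
  have "inner x x = 0 \<longleftrightarrow> (\<forall>n. (cmod (coord x n))\<^sup>2 = 0)"
    unfolding norm_suminf by (rule suminf_eq_zero_iff[OF summable_coord]) simp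
  also have "\<dots> \<longleftrightarrow> (\<forall>n. coord x n = coord 0 n)"
    by (simp add: coord_zero)
  also have "\<dots> \<longleftrightarrow> x = 0"
    using ell2_eqI by blast
  finally show "inner x x = 0 \<longleftrightarrow> x = 0" .
qed

end

lemma norm_ell2_eq: "norm x = sqrt (\<Sum>n. (cmod (coord x n))\<^sup>2)"
proof -
  have "(\<lambda>n. Re (cnj (coord x n) * coord x n)) = (\<lambda>n. (cmod (coord x n))\<^sup>2)"
    unfolding cmod_power2 by (simp add: power2_eq_square)
  then show ?thesis
    unfolding norm_ell2_def inner_ell2_def cinner_def Re_suminf[OF summable_cinner]
    by (rule arg_cong[where f = "\<lambda>f. sqrt (suminf f)"])
qed

lemma norm_ell2_power2: "(norm x)\<^sup>2 = (\<Sum>n. (cmod (coord x n))\<^sup>2)"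
  unfolding norm_ell2_eq
  by (rule real_sqrt_pow2, rule suminf_nonneg[OF summable_coord]) simp

lemma sum_coord_le_norm: "(\<Sum>n<N. (cmod (coord x n))\<^sup>2) \<le> (norm x)\<^sup>2"
  unfolding norm_ell2_power2 by (rule sum_le_suminf[OF summable_coord]) simp_all

lemma cmod_coord_le_norm: "cmod (coord x n) \<le> norm x"
proof (rule power2_le_imp_le)
  have "(cmod (coord x n))\<^sup>2 \<le> (\<Sum>k<Suc n. (cmod (coord x k))\<^sup>2)"
    by (rule member_le_sum) simp_all
  also have "\<dots> \<le> (norm x)\<^sup>2" by (rule sum_coord_le_norm)
  finally show "(cmod (coord x n))\<^sup>2 \<le> (norm x)\<^sup>2" .
qed simp

instance ell2 :: complete_space
proof
  fix X :: "nat \<Rightarrow> ell2" assume X: "Cauchy X"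
  have le: "cmod (coord (X m) n - coord (X k) n) \<le> norm (X m - X k)" for m k n
    using cmod_coord_le_norm[of "X m - X k" n] by (simp add: coord_diff)
  have "Cauchy (\<lambda>m. coord (X m) n)" for n
  proof (rule CauchyI)
    fix e :: real assume "0 < e"
    then obtain M where "\<forall>m\<ge>M. \<forall>k\<ge>M. norm (X m - X k) < e"
      using CauchyD[OF X] by blast
    then show "\<exists>M. \<forall>m\<ge>M. \<forall>k\<ge>M. norm (coord (X m) n - coord (X k) n) < e"
      using le le_less_trans by blast
  qed
  then have "\<exists>l. (\<lambda>m. coord (X m) n) \<longlonglongrightarrow> l" for n
    using Cauchy_convergent_iff convergent_def by blast
  then obtain f where f: "\<And>n. (\<lambda>m. coord (X m) n) \<longlonglongrightarrow> f n"
    using choice[of "\<lambda>n l. (\<lambda>m. coord (X m) n) \<longlonglongrightarrow> l"] by blast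
  have tail: "\<exists>M. \<forall>m\<ge>M. \<forall>N. (\<Sum>n<N. (cmod (f n - coord (X m) n))\<^sup>2) \<le> e\<^sup>2" if "e > 0" for e
  proof -
    obtain M where M: "\<And>m k. m \<ge> M \<Longrightarrow> k \<ge> M \<Longrightarrow> norm (X k - X m) < e"
      using X \<open>e > 0\<close> unfolding Cauchy_def dist_norm by blast
    have "(\<Sum>n<N. (cmod (f n - coord (X m) n))\<^sup>2) \<le> e\<^sup>2" if m: "m \<ge> M" for m N
    proof (rule LIMSEQ_le_const2)
      show "(\<lambda>k. \<Sum>n<N. (cmod (coord (X k) n - coord (X m) n))\<^sup>2)
          \<longlonglongrightarrow> (\<Sum>n<N. (cmod (f n - coord (X m) n))\<^sup>2)"
        by (intro tendsto_intros f)
      have "(\<Sum>n<N. (cmod (coord (X k) n - coord (X m) n))\<^sup>2) \<le> e\<^sup>2" if k: "k \<ge> M" for k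
      proof -
        have "(\<Sum>n<N. (cmod (coord (X k - X m) n))\<^sup>2) \<le> (norm (X k - X m))\<^sup>2"
          by (rule sum_coord_le_norm)
        also have "\<dots> \<le> e\<^sup>2" using M[OF m k] by (intro power_mono) auto
        finally show ?thesis by (simp add: coord_diff)
      qed
      then show "\<exists>K. \<forall>k\<ge>K. (\<Sum>n<N. (cmod (coord (X k) n - coord (X m) n))\<^sup>2) \<le> e\<^sup>2" by blast
    qed
    then show ?thesis by blast
  qed
  obtain m where m: "\<And>N. (\<Sum>n<N. (cmod (f n - coord (X m) n))\<^sup>2) \<le> 1"
    using tail[of 1] by auto
  have "summable (\<lambda>n. (cmod (f n - coord (X m) n))\<^sup>2)"
    by (rule summableI_nonneg_bounded[where x = 1]) (use m in auto)
  from square_summable_add[OF this summable_coord[of "X m"]]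
  have sf: "summable (\<lambda>n. (cmod (f n))\<^sup>2)" by simp
  define L where "L = Abs_ell2 f"
  have L: "coord L n = f n" for n
    unfolding L_def using sf by (simp add: Abs_ell2_inverse)
  have "X \<longlonglongrightarrow> L"
  proof (rule LIMSEQ_I)
    fix r :: real assume r: "0 < r"
    obtain M where M: "\<And>m N. m \<ge> M \<Longrightarrow> (\<Sum>n<N. (cmod (f n - coord (X m) n))\<^sup>2) \<le> (r/2)\<^sup>2"
      using tail[of "r/2"] r by auto
    have "norm (X m - L) < r" if "m \<ge> M" for m
    proof -
      have "(\<Sum>n. (cmod (coord (L - X m) n))\<^sup>2) \<le> (r/2)\<^sup>2"
        using M[OF that] by (intro suminf_le_const summable_coord) (simp add: coord_diff L)
      then have "norm (L - X m) \<le> r/2"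
        unfolding norm_ell2_eq using r by (intro real_le_lsqrt) auto
      then show ?thesis using r by (simp add: norm_minus_commute)
    qed
    then show "\<exists>no. \<forall>n\<ge>no. norm (X n - L) < r" by blast
  qed
  then show "convergent X" by (auto simp: convergent_def)
qed

instance ell2 :: banach ..

text \<open>
  Operators are bounded real-linear maps of the library; \<open>cscale c\<close> is the operator \<open>c 1\<close>, so
  complex linearity means commuting with every \<open>cscale c\<close>, and \<open>cscale c o\<^sub>L T\<close> is the operator \<open>c T\<close>.
\<close>

type_synonym op = "ell2 \<Rightarrow>\<^sub>L ell2"

definition cscale :: "complex \<Rightarrow> op" where
  "cscale c = Blinfun (\<lambda>x. Abs_ell2 (\<lambda>n. c * coord x n))"

lemma coord_cscale: "coord (blinfun_apply (cscale c) x) n = c * coord x n"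
proof -
  define F where "F = (\<lambda>x. Abs_ell2 (\<lambda>n. c * coord x n))"
  have F: "coord (F x) n = c * coord x n" for x n
    using square_summable_mult[OF summable_coord[of x], of c]
    by (simp add: F_def Abs_ell2_inverse)
  have nF: "norm (F x) \<le> norm x * cmod c" for x
  proof -
    have "(\<Sum>n. (cmod (coord (F x) n))\<^sup>2) = (\<Sum>n. (cmod c)\<^sup>2 * (cmod (coord x n))\<^sup>2)"
      by (simp only: F norm_mult power_mult_distrib)
    also have "\<dots> = (cmod c)\<^sup>2 * (\<Sum>n. (cmod (coord x n))\<^sup>2)"
      by (rule suminf_mult[OF summable_coord])
    finally show ?thesis
      unfolding norm_ell2_eq by (simp add: real_sqrt_mult)
  qed
  have "bounded_linear F"
  proof (rule bounded_linear_intro[where K = "cmod c"])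
    show "F (x + y) = F x + F y" for x y
      by (rule ell2_eqI) (simp add: F coord_add distrib_left)
    show "F (r *\<^sub>R x) = r *\<^sub>R F x" for r x
      by (rule ell2_eqI) (simp add: F coord_scaleR)
  qed (rule nF)
  then have "blinfun_apply (cscale c) = F"
    unfolding cscale_def F_def[symmetric] by (rule bounded_linear_Blinfun_apply)
  then show ?thesis by (simp add: F)
qed

definition bounded_ops :: "op set" where
  "bounded_ops = {T. \<forall>c. T o\<^sub>L cscale c = cscale c o\<^sub>L T}"

definition adj :: "op \<Rightarrow> op" where
  "adj T = (THE S. \<forall>x y. cinner (blinfun_apply S x) y = cinner x (blinfun_apply T y))"


section \<open>Tracial von Neumann algebras\<close>

definition commutant :: "op set \<Rightarrow> op set" where
  "commutant S = {T \<in> bounded_ops. \<forall>s\<in>S. T o\<^sub>L s = s o\<^sub>L T}"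

definition von_neumann_algebra :: "op set \<Rightarrow> bool" where
  "von_neumann_algebra M \<longleftrightarrow> (\<forall>x\<in>M. adj x \<in> M) \<and> commutant (commutant M) = M"

definition op_le :: "op \<Rightarrow> op \<Rightarrow> bool" where
  "op_le x y \<longleftrightarrow> (\<forall>h. Re (cinner h (blinfun_apply x h)) \<le> Re (cinner h (blinfun_apply y h)))"

definition sa_ops :: "op set \<Rightarrow> op set" where
  "sa_ops M = {x \<in> M. adj x = x}"

definition state_on :: "op set \<Rightarrow> (op \<Rightarrow> complex) \<Rightarrow> bool" where
  "state_on M \<tau> \<longleftrightarrow>
     (\<forall>x\<in>M. \<forall>y\<in>M. \<tau> (x + y) = \<tau> x + \<tau> y) \<and>
     (\<forall>c. \<forall>x\<in>M. \<tau> (cscale c o\<^sub>L x) = c * \<tau> x) \<and>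
     (\<forall>x\<in>M. \<tau> (adj x o\<^sub>L x) \<in> \<real> \<and> 0 \<le> Re (\<tau> (adj x o\<^sub>L x))) \<and>
     \<tau> id_blinfun = 1"

text \<open>Normality: suprema of bounded upward directed families of self-adjoint elements are preserved.\<close>

definition normal_on :: "op set \<Rightarrow> (op \<Rightarrow> complex) \<Rightarrow> bool" where
  "normal_on M \<tau> \<longleftrightarrow>
     (\<forall>D s. D \<noteq> {} \<and> D \<subseteq> sa_ops M \<and>
        (\<forall>x\<in>D. \<forall>y\<in>D. \<exists>z\<in>D. op_le x z \<and> op_le y z) \<and>
        s \<in> sa_ops M \<and> (\<forall>x\<in>D. op_le x s) \<and>
        (\<forall>u\<in>sa_ops M. (\<forall>x\<in>D. op_le x u) \<longrightarrow> op_le s u)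
      \<longrightarrow> Re (\<tau> s) = (SUP x\<in>D. Re (\<tau> x)))"

text \<open>
  A von Neumann algebra with separable predual is isomorphic to one acting on \<open>\<ell>\<^sup>2\<close> (amplify a
  faithful normal representation on a separable space), and every von Neumann algebra on \<open>\<ell>\<^sup>2\<close> has
  separable predual. So the pairs below contain, up to isomorphism, exactly the tracial
  \<open>W\<^sup>*\<close>-algebras with separable predual. Only the values of \<open>tr\<close> on \<open>car\<close> matter.
\<close>

record wstar =
  car :: "op set"
  tr :: "op \<Rightarrow> complex"

definition tracial_wstar :: "wstar \<Rightarrow> bool" where
  "tracial_wstar A \<longleftrightarrow>
     von_neumann_algebra (car A) \<and> state_on (car A) (tr A) \<and> normal_on (car A) (tr A) \<and>
     (\<forall>x\<in>car A. \<forall>y\<in>car A. tr A (x o\<^sub>L y) = tr A (y o\<^sub>L x)) \<and>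
     (\<forall>x\<in>car A. tr A (adj x o\<^sub>L x) = 0 \<longrightarrow> x = 0)"

definition wstar_embedding :: "wstar \<Rightarrow> wstar \<Rightarrow> (op \<Rightarrow> op) \<Rightarrow> bool" where
  "wstar_embedding A B \<iota> \<longleftrightarrow>
     \<iota> ` car A \<subseteq> car B \<and>
     (\<forall>x\<in>car A. \<forall>y\<in>car A. \<iota> (x + y) = \<iota> x + \<iota> y) \<and>
     (\<forall>c. \<forall>x\<in>car A. \<iota> (cscale c o\<^sub>L x) = cscale c o\<^sub>L \<iota> x) \<and>
     (\<forall>x\<in>car A. \<forall>y\<in>car A. \<iota> (x o\<^sub>L y) = \<iota> x o\<^sub>L \<iota> y) \<and>
     (\<forall>x\<in>car A. \<iota> (adj x) = adj (\<iota> x)) \<and>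
     \<iota> id_blinfun = id_blinfun \<and>
     (\<forall>x\<in>car A. tr B (\<iota> x) = tr A x)"

definition wstar_isomorphic :: "wstar \<Rightarrow> wstar \<Rightarrow> bool" where
  "wstar_isomorphic A B \<longleftrightarrow> (\<exists>\<iota>. wstar_embedding A B \<iota> \<and> bij_betw \<iota> (car A) (car B))"

definition wstar_representatives :: "wstar set \<Rightarrow> bool" where
  "wstar_representatives W \<longleftrightarrow>
     (\<forall>A\<in>W. tracial_wstar A) \<and>
     (\<forall>A. tracial_wstar A \<longrightarrow> (\<exists>!B. B \<in> W \<and> wstar_isomorphic A B))"


section \<open>The space \<open>L\<^sup>2\<close>\<close>

text \<open>
  The completion of \<open>A\<close> for \<open>\<langle>x,y\<rangle> = \<tau>(x\<^sup>* y)\<close> is determined by a complex-linear map into a Hilbert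
  space that preserves this product; the completion is the closure of its range. The target \<open>\<ell>\<^sup>2\<close>
  is no restriction: for separable predual the completion is separable. A family \<open>\<eta>\<close> fixes one model
  of the completion for each algebra.
\<close>

definition L2_model :: "wstar \<Rightarrow> (op \<Rightarrow> ell2) \<Rightarrow> bool" where
  "L2_model A e \<longleftrightarrow>
     (\<forall>x\<in>car A. \<forall>y\<in>car A. e (x + y) = e x + e y) \<and>
     (\<forall>c. \<forall>x\<in>car A. e (cscale c o\<^sub>L x) = blinfun_apply (cscale c) (e x)) \<and>
     (\<forall>x\<in>car A. \<forall>y\<in>car A. cinner (e x) (e y) = tr A (adj x o\<^sub>L y))"

type_synonym model = "wstar \<Rightarrow> op \<Rightarrow> ell2"

definition L2 :: "model \<Rightarrow> wstar \<Rightarrow> ell2 set" where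
  "L2 \<eta> A = closure (\<eta> A ` car A)"

text \<open>Extension by continuity, from the dense copy of \<open>A\<close> to \<open>L2\<close>, of a map \<open>f\<close> defined on \<open>A\<close>.\<close>

definition L2_extend :: "model \<Rightarrow> wstar \<Rightarrow> (op \<Rightarrow> ell2) \<Rightarrow> ell2 \<Rightarrow> ell2" where
  "L2_extend \<eta> A f \<xi> =
     (THE \<zeta>. \<forall>x. (\<forall>n. x n \<in> car A) \<and> (\<lambda>n. \<eta> A (x n)) \<longlonglongrightarrow> \<xi> \<longrightarrow> (\<lambda>n. f (x n)) \<longlonglongrightarrow> \<zeta>)"

definition L2_adj :: "model \<Rightarrow> wstar \<Rightarrow> ell2 \<Rightarrow> ell2" where
  "L2_adj \<eta> A = L2_extend \<eta> A (\<lambda>x. \<eta> A (adj x))"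

definition L2d :: "model \<Rightarrow> wstar \<Rightarrow> (ell2 ^ 'd::finite) set" where
  "L2d \<eta> A = {X. \<forall>j. X $ j \<in> L2 \<eta> A}"

definition L2d_sa :: "model \<Rightarrow> wstar \<Rightarrow> (ell2 ^ 'd::finite) set" where
  "L2d_sa \<eta> A = {X. \<forall>j. X $ j \<in> L2 \<eta> A \<and> L2_adj \<eta> A (X $ j) = X $ j}"

text \<open>
  The real part of \<open>cinner_tuple\<close> is the library's \<open>inner\<close> on the type of tuples, whence
  the library's \<open>norm\<close>, \<open>closed\<close>, \<open>convex\<close> on tuples are those of \<open>L\<^sup>2(A)\<^sup>d\<close>.
\<close>

definition cinner_tuple :: "ell2 ^ 'd::finite \<Rightarrow> ell2 ^ 'd \<Rightarrow> complex" where
  "cinner_tuple X Y = (\<Sum>j\<in>UNIV. cinner (X $ j) (Y $ j))"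

lemma Re_cinner_tuple: "Re (cinner_tuple X Y) = inner X Y"
  by (simp add: cinner_tuple_def inner_vec_def inner_ell2_def)

definition emb_tuple ::
  "model \<Rightarrow> wstar \<Rightarrow> wstar \<Rightarrow> (op \<Rightarrow> op) \<Rightarrow> ell2 ^ 'd::finite \<Rightarrow> ell2 ^ 'd" where
  "emb_tuple \<eta> A B \<iota> X = (\<chi> j. L2_extend \<eta> A (\<lambda>x. \<eta> B (\<iota> x)) (X $ j))"

definition cond_exp ::
  "model \<Rightarrow> wstar \<Rightarrow> wstar \<Rightarrow> (op \<Rightarrow> op) \<Rightarrow> ell2 ^ 'd::finite \<Rightarrow> ell2 ^ 'd" where
  "cond_exp \<eta> A B \<iota> P =
     (THE Q. Q \<in> L2d \<eta> A \<and>
        (\<forall>X\<in>L2d \<eta> A. cinner_tuple (emb_tuple \<eta> A B \<iota> X) P = cinner_tuple X Q))"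


section \<open>Tracial \<open>W\<^sup>*\<close>-functions and the standing assumptions\<close>

definition tracial_wstar_function ::
  "wstar set \<Rightarrow> model \<Rightarrow> (wstar \<Rightarrow> ell2 ^ 'd::finite \<Rightarrow> ereal) \<Rightarrow> bool" where
  "tracial_wstar_function W \<eta> f \<longleftrightarrow>
     (\<forall>A\<in>W. \<forall>X\<in>L2d_sa \<eta> A. f A X \<noteq> -\<infinity>) \<and>
     (\<forall>A\<in>W. \<forall>B\<in>W. \<forall>\<iota>. wstar_embedding A B \<iota> \<longrightarrow>
        (\<forall>X\<in>L2d_sa \<eta> A. f A X = f B (emb_tuple \<eta> A B \<iota> X)))"

text \<open>Two variables, the second one ranging over a given family \<open>D\<close> of sets.\<close>

definition tracial_wstar_function2 ::
  "wstar set \<Rightarrow> model \<Rightarrow> (wstar \<Rightarrow> (ell2 ^ 'd) set) \<Rightarrow>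
   (wstar \<Rightarrow> ell2 ^ 'd::finite \<Rightarrow> ell2 ^ 'd \<Rightarrow> ereal) \<Rightarrow> bool" where
  "tracial_wstar_function2 W \<eta> D f \<longleftrightarrow>
     (\<forall>A\<in>W. \<forall>X\<in>L2d_sa \<eta> A. \<forall>P\<in>D A. f A X P \<noteq> -\<infinity>) \<and>
     (\<forall>A\<in>W. \<forall>B\<in>W. \<forall>\<iota>. wstar_embedding A B \<iota> \<longrightarrow>
        (\<forall>X\<in>L2d_sa \<eta> A. \<forall>P\<in>D A.
           f A X P = f B (emb_tuple \<eta> A B \<iota> X) (emb_tuple \<eta> A B \<iota> P)))"

definition modulus_of_continuity :: "(real \<Rightarrow> real) \<Rightarrow> bool" where
  "modulus_of_continuity \<omega> \<longleftrightarrow>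
     (\<forall>r\<ge>0. 0 \<le> \<omega> r) \<and> mono_on {0..} \<omega> \<and> \<omega> 0 = 0 \<and> (\<omega> \<longlongrightarrow> 0) (at_right 0)"

definition controls_assumption ::
  "wstar set \<Rightarrow> model \<Rightarrow> (wstar \<Rightarrow> (ell2 ^ 'd::finite) set) \<Rightarrow> bool" where
  "controls_assumption W \<eta> Adm \<longleftrightarrow>
     (\<forall>A\<in>W. Adm A \<subseteq> L2d_sa \<eta> A \<and> closed (Adm A) \<and> convex (Adm A) \<and> 0 \<in> Adm A) \<and>
     (\<forall>A\<in>W. \<forall>B\<in>W. \<forall>\<iota>. wstar_embedding A B \<iota> \<longrightarrow>
        emb_tuple \<eta> A B \<iota> ` Adm A \<subseteq> Adm B \<and> cond_exp \<eta> A B \<iota> ` Adm B \<subseteq> Adm A)"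

definition drift_assumption ::
  "wstar set \<Rightarrow> model \<Rightarrow> (wstar \<Rightarrow> (ell2 ^ 'd::finite) set) \<Rightarrow>
   (wstar \<Rightarrow> ell2 ^ 'd \<Rightarrow> ell2 ^ 'd \<Rightarrow> ell2 ^ 'd) \<Rightarrow> real \<Rightarrow> bool" where
  "drift_assumption W \<eta> Adm b Cbar \<longleftrightarrow>
     (\<forall>A\<in>W. \<forall>X\<in>L2d_sa \<eta> A. \<forall>\<alpha>\<in>Adm A. b A X \<alpha> \<in> L2d_sa \<eta> A) \<and>
     (\<forall>A\<in>W. \<forall>B\<in>W. \<forall>\<iota>. wstar_embedding A B \<iota> \<longrightarrow>
        (\<forall>X\<in>L2d_sa \<eta> A. \<forall>\<alpha>\<in>Adm A.
           emb_tuple \<eta> A B \<iota> (b A X \<alpha>) = b B (emb_tuple \<eta> A B \<iota> X) (emb_tuple \<eta> A B \<iota> \<alpha>))) \<and>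
     (\<forall>A\<in>W. \<forall>X\<in>L2d_sa \<eta> A. \<forall>\<alpha>\<in>Adm A. \<forall>\<beta>\<in>Adm A. \<forall>t\<in>{0..1}.
        b A X ((1 - t) *\<^sub>R \<alpha> + t *\<^sub>R \<beta>) = (1 - t) *\<^sub>R b A X \<alpha> + t *\<^sub>R b A X \<beta>) \<and>
     (\<forall>A\<in>W. \<forall>B\<in>W. \<forall>\<iota>. wstar_embedding A B \<iota> \<longrightarrow>
        (\<forall>X\<in>L2d_sa \<eta> A. \<forall>\<alpha>\<in>Adm B.
           b A X (cond_exp \<eta> A B \<iota> \<alpha>) = cond_exp \<eta> A B \<iota> (b B (emb_tuple \<eta> A B \<iota> X) \<alpha>))) \<and>
     (\<forall>M>0. \<exists>\<omega>. modulus_of_continuity \<omega> \<and>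
        (\<forall>A\<in>W. \<forall>X\<in>L2d_sa \<eta> A. \<forall>Y\<in>L2d_sa \<eta> A. \<forall>\<alpha>\<in>Adm A. \<forall>\<beta>\<in>Adm A.
           norm X \<le> M \<and> norm Y \<le> M \<and> norm \<alpha> \<le> M \<and> norm \<beta> \<le> M \<longrightarrow>
           (norm (b A X \<alpha> - b A Y \<beta>))\<^sup>2 \<le> \<omega> ((norm (X - Y))\<^sup>2 + (norm (\<alpha> - \<beta>))\<^sup>2))) \<and>
     Cbar > 0 \<and>
     (\<forall>A\<in>W. \<forall>X\<^sub>1\<in>L2d_sa \<eta> A. \<forall>X\<^sub>2\<in>L2d_sa \<eta> A. \<forall>\<alpha>\<in>Adm A.
        norm (b A X\<^sub>1 \<alpha> - b A X\<^sub>2 \<alpha>) \<le> Cbar * norm (X\<^sub>1 - X\<^sub>2))"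

definition costs_assumption ::
  "wstar set \<Rightarrow> model \<Rightarrow> (wstar \<Rightarrow> (ell2 ^ 'd::finite) set) \<Rightarrow>
   (wstar \<Rightarrow> ell2 ^ 'd \<Rightarrow> ell2 ^ 'd \<Rightarrow> real) \<Rightarrow> (wstar \<Rightarrow> ell2 ^ 'd \<Rightarrow> real) \<Rightarrow>
   real \<Rightarrow> real \<Rightarrow> bool" where
  "costs_assumption W \<eta> Adm L g C\<^sub>1 C\<^sub>2 \<longleftrightarrow>
     tracial_wstar_function2 W \<eta> Adm (\<lambda>A X \<alpha>. ereal (L A X \<alpha>)) \<and>
     tracial_wstar_function W \<eta> (\<lambda>A X. ereal (g A X)) \<and>
     (\<forall>A\<in>W. \<forall>X\<in>L2d_sa \<eta> A. convex_on (Adm A) (L A X)) \<and>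
     (\<forall>A\<in>W. \<forall>B\<in>W. \<forall>\<iota>. wstar_embedding A B \<iota> \<longrightarrow>
        (\<forall>X\<in>L2d_sa \<eta> A. \<forall>\<alpha>\<in>Adm B.
           L A X (cond_exp \<eta> A B \<iota> \<alpha>) \<le> L B (emb_tuple \<eta> A B \<iota> X) \<alpha>)) \<and>
     (\<forall>M>0. \<forall>\<epsilon>>0. \<exists>\<delta>>0.
        \<forall>A\<in>W. \<forall>X\<in>L2d_sa \<eta> A. \<forall>Y\<in>L2d_sa \<eta> A. \<forall>\<alpha>\<in>Adm A. \<forall>\<beta>\<in>Adm A.
          norm X \<le> M \<and> norm Y \<le> M \<and> norm \<alpha> \<le> M \<and> norm \<beta> \<le> M \<and>
          norm (X - Y) < \<delta> \<and> norm (\<alpha> - \<beta>) < \<delta> \<longrightarrow> \<bar>L A X \<alpha> - L A Y \<beta>\<bar> < \<epsilon>) \<and>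
     C\<^sub>1 > 0 \<and> C\<^sub>2 > 0 \<and>
     (\<forall>A\<in>W. \<forall>X\<in>L2d_sa \<eta> A. \<forall>\<alpha>\<in>Adm A.
        - C\<^sub>1 + 1 / C\<^sub>1 * (norm \<alpha>)\<^sup>2 \<le> L A X \<alpha> \<and>
        L A X \<alpha> \<le> C\<^sub>1 * (1 + norm X + (norm \<alpha>)\<^sup>2)) \<and>
     (\<forall>A\<in>W. \<forall>X\<in>L2d_sa \<eta> A. - C\<^sub>1 \<le> g A X \<and> g A X \<le> C\<^sub>1 * (1 + norm X)) \<and>
     (\<forall>A\<in>W. \<forall>X\<^sub>1\<in>L2d_sa \<eta> A. \<forall>X\<^sub>2\<in>L2d_sa \<eta> A. \<forall>\<alpha>\<in>Adm A.
        \<bar>L A X\<^sub>1 \<alpha> - L A X\<^sub>2 \<alpha>\<bar> \<le> C\<^sub>2 * norm (X\<^sub>1 - X\<^sub>2)) \<and>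
     (\<forall>A\<in>W. \<forall>X\<^sub>1\<in>L2d_sa \<eta> A. \<forall>X\<^sub>2\<in>L2d_sa \<eta> A.
        \<bar>g A X\<^sub>1 - g A X\<^sub>2\<bar> \<le> C\<^sub>2 * norm (X\<^sub>1 - X\<^sub>2))"

text \<open>The inner product of self-adjoint tuples is real; \<open>Re\<close> only adjusts the type.\<close>

definition hamiltonian ::
  "wstar set \<Rightarrow> model \<Rightarrow> (wstar \<Rightarrow> (ell2 ^ 'd::finite) set) \<Rightarrow>
   (wstar \<Rightarrow> ell2 ^ 'd \<Rightarrow> ell2 ^ 'd \<Rightarrow> ell2 ^ 'd) \<Rightarrow>
   (wstar \<Rightarrow> ell2 ^ 'd \<Rightarrow> ell2 ^ 'd \<Rightarrow> real) \<Rightarrow>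
   wstar \<Rightarrow> ell2 ^ 'd \<Rightarrow> ell2 ^ 'd \<Rightarrow> ereal" where
  "hamiltonian W \<eta> Adm b L A X P =
     (SUP (B, \<iota>) \<in> {(B, \<iota>). B \<in> W \<and> wstar_embedding A B \<iota>}. SUP \<alpha>\<in>Adm B.
        ereal (Re (cinner_tuple (b B (emb_tuple \<eta> A B \<iota> X) \<alpha>) (emb_tuple \<eta> A B \<iota> P))
               - L B (emb_tuple \<eta> A B \<iota> X) \<alpha>))"

text \<open>
  For functions with values in \<open>(-\<infinity>,+\<infinity>]\<close>, where the library's \<open>convex_on\<close> does not apply.
\<close>

definition E_convex_snd ::
  "wstar set \<Rightarrow> model \<Rightarrow> (wstar \<Rightarrow> ell2 ^ 'd::finite \<Rightarrow> ell2 ^ 'd \<Rightarrow> ereal) \<Rightarrow> bool" where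
  "E_convex_snd W \<eta> f \<longleftrightarrow>
     (\<forall>A\<in>W. \<forall>X\<in>L2d_sa \<eta> A. \<forall>P\<in>L2d_sa \<eta> A. \<forall>Q\<in>L2d_sa \<eta> A. \<forall>t\<in>{0..1}.
        f A X ((1 - t) *\<^sub>R P + t *\<^sub>R Q) \<le> ereal (1 - t) * f A X P + ereal t * f A X Q) \<and>
     (\<forall>A\<in>W. \<forall>B\<in>W. \<forall>\<iota>. wstar_embedding A B \<iota> \<longrightarrow>
        (\<forall>X\<in>L2d_sa \<eta> A. \<forall>P\<in>L2d_sa \<eta> B.
           f A X (cond_exp \<eta> A B \<iota> P) \<le> f B (emb_tuple \<eta> A B \<iota> X) P))"

end

theory Submission
  imports Defs
begin

text \<open>
  The supremum defining the Hamiltonian runs over all algebras extending \<open>A\<close>, but nothing is gained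
  by leaving \<open>A\<close>. Given an embedding \<open>\<iota>\<close> of \<open>A\<close> into \<open>B\<close> and a control \<open>\<alpha>\<close> of \<open>B\<close>, replace \<open>\<alpha>\<close> by its
  conditional expectation \<open>E \<alpha>\<close>, a control of \<open>A\<close>. As \<open>E\<close> is the adjoint of \<open>\<iota>\<close> and commutes with the
  drift, the term \<open>\<langle>b, P\<rangle>\<close> does not change, and the Jensen-type assumption on \<open>L\<close> says that the cost
  does not increase (\<open>gain_le_gain_cond_exp\<close>). Hence the supremum over the controls of \<open>B\<close> is at most
  the supremum over the controls of \<open>A\<close>. Conversely, for every \<open>P\<close> in \<open>L\<^sup>2(B)\<close> a control of \<open>A\<close> earns
  against \<open>E P\<close> what its image in \<open>B\<close> earns against \<open>P\<close> (\<open>gain_cond_exp_momentum\<close>); this is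
  \<open>E\<close>-convexity, and with \<open>P\<close> replaced by \<open>\<iota> P\<close>, where \<open>E (\<iota> P) = P\<close>, it is the opposite inequality.
  So the supremum over the controls of a single algebra is invariant under embeddings
  (\<open>ham_emb_eq\<close>). All the terms of the outer supremum in the definition therefore agree with the one
  for \<open>A\<close>, which is the first claim, and the invariance also makes the Hamiltonian a tracial
  \<open>W\<^sup>*\<close>-function.

  What remains concerns one real inner product space and is done in the locale \<open>control_system\<close>.
  Being affine in the control, the drift grows at most linearly in it, so that the quadratic lower
  bound of the cost makes the gain coercive: on bounded sets of \<open>(X, P)\<close> the supremum is finite and
  only controls from a fixed ball matter. On such controls the gain is Lipschitz in \<open>P\<close>, and it is
  Lipschitz in \<open>X\<close> by assumption, with constant \<open>Cbar |P| + C\<^sub>2\<close>. This gives uniform continuity, and for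
  \<open>P = \<gamma> (X - Y)\<close> the explicit estimate, after splitting \<open>C\<^sub>2 |X - Y|\<close> by the arithmetic-geometric mean
  inequality.

  The conditional expectation of the statement is given by a definite description, as are operator
  adjoints and extensions by continuity. Their existence comes from one Riesz representation theorem
  on complete subspaces (\<open>riesz_on_complete_subspace\<close>) and from the observation that a map preserving
  inner products extends to the closure and is automatically linear there.
\<close>

section \<open>Riesz representation and operator adjoints\<close>

text \<open>
  The representing vector is the minimiser of \<open>|x|\<^sup>2 - 2 f x\<close>: the parallelogram law makes every
  minimising sequence Cauchy, and minimality in the direction \<open>v\<close> says \<open>f v = \<langle>v, y\<rangle>\<close>.
\<close>

lemma riesz_on_complete_subspace:
  fixes S :: "'a::real_inner set" and f :: "'a \<Rightarrow> real"
  assumes S: "subspace S" "complete S"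
    and add: "\<And>x y. x \<in> S \<Longrightarrow> y \<in> S \<Longrightarrow> f (x + y) = f x + f y"
    and scale: "\<And>r x. x \<in> S \<Longrightarrow> f (r *\<^sub>R x) = r * f x"
    and bound: "\<And>x. x \<in> S \<Longrightarrow> \<bar>f x\<bar> \<le> K * norm x"
  shows "\<exists>y\<in>S. \<forall>x\<in>S. f x = inner x y"
proof -
  define q where "q x = (norm x)\<^sup>2 - 2 * f x" for x
  define m where "m = (INF x\<in>S. q x)"
  have "q x \<ge> - K\<^sup>2" if "x \<in> S" for x
  proof -
    have "0 \<le> (norm x - K)\<^sup>2" by simp
    then show ?thesis
      using bound[OF that] by (simp add: q_def power2_eq_square algebra_simps)
  qed
  then have bdd: "bdd_below (q ` S)" by (intro bdd_belowI2)
  have m_le: "m \<le> q x" if "x \<in> S" for x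
    unfolding m_def using bdd that by (intro cINF_lower)
  have ne: "S \<noteq> {}" using subspace_0[OF S(1)] by blast
  have "\<exists>x\<in>S. q x < m + 1 / Suc n" for n
    using cINF_less_iff[OF ne bdd, of "m + 1 / Suc n"] by (simp add: m_def)
  then obtain x where x: "\<And>n. x n \<in> S" "\<And>n. q (x n) < m + 1 / Suc n" by metis
  have close: "(norm (x i - x j))\<^sup>2 < 2 / Suc i + 2 / Suc j" for i j
  proof -
    let ?z = "(1/2) *\<^sub>R (x i + x j)"
    have zS: "?z \<in> S" by (intro subspace_scale subspace_add S x)
    have "f ?z = (f (x i) + f (x j)) / 2"
      using scale[of "x i + x j" "1/2"] add[of "x i" "x j"] subspace_add[OF S(1)] x by simp
    then have "(norm (x i - x j))\<^sup>2 = 2 * q (x i) + 2 * q (x j) - 4 * q ?z"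
      unfolding q_def power2_norm_eq_inner
      by (simp add: inner_add_left inner_add_right inner_diff_left inner_diff_right inner_commute
          field_simps)
    moreover have "2 / Suc k = 2 * (1 / Suc k)" for k by simp
    ultimately show ?thesis using m_le[OF zS] x(2)[of i] x(2)[of j] by linarith
  qed
  have "Cauchy x"
  proof (rule CauchyI)
    fix e :: real assume e: "0 < e"
    obtain N where N: "inverse (real (Suc N)) < e\<^sup>2 / 4"
      using reals_Archimedean[of "e\<^sup>2/4"] e by auto
    have "norm (x i - x j) < e" if "i \<ge> N" "j \<ge> N" for i j
    proof -
      have "2 / Suc k \<le> 2 * inverse (real (Suc N))" if "k \<ge> N" for k
        using that by (simp add: field_simps)
      then have "2 / Suc i \<le> 2 * inverse (real (Suc N))" "2 / Suc j \<le> 2 * inverse (real (Suc N))"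
        using \<open>i \<ge> N\<close> \<open>j \<ge> N\<close> by blast+
      then have "(norm (x i - x j))\<^sup>2 < e\<^sup>2"
        using close[of i j] N by linarith
      then show ?thesis using e by (auto intro: power_less_imp_less_base)
    qed
    then show "\<exists>M. \<forall>i\<ge>M. \<forall>j\<ge>M. norm (x i - x j) < e" by blast
  qed
  then obtain y where y: "y \<in> S" "x \<longlonglongrightarrow> y"
    using S(2) x(1) unfolding complete_def by blast
  have "f (x n) - f y = f (x n - y)" for n
    using add[of "x n - y" y] x(1) y(1) subspace_diff[OF S(1)] by simp
  then have "\<bar>f (x n) - f y\<bar> \<le> K * norm (x n - y)" for n
    using bound[of "x n - y"] x(1) y(1) subspace_diff[OF S(1)] by simp
  then have "\<forall>\<^sub>F n in sequentially. norm (f (x n) - f y) \<le> K * norm (x n - y)"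
    by simp
  moreover have "(\<lambda>n. K * norm (x n - y)) \<longlonglongrightarrow> 0"
    by (intro tendsto_mult_right_zero tendsto_norm_zero LIM_zero y)
  ultimately have "(\<lambda>n. f (x n) - f y) \<longlonglongrightarrow> 0"
    by (rule Lim_null_comparison)
  then have "(\<lambda>n. f (x n)) \<longlonglongrightarrow> f y" by (rule LIM_zero_cancel)
  then have "(\<lambda>n. q (x n)) \<longlonglongrightarrow> q y"
    unfolding q_def by (intro tendsto_intros y)
  moreover have "(\<lambda>n. m + 1 / Suc n) \<longlonglongrightarrow> m"
    using LIMSEQ_inverse_real_of_nat_add[of m] by (simp add: divide_inverse)
  ultimately have "q y \<le> m"
    by (rule LIMSEQ_le) (use x(2) less_imp_le in blast)
  have "f v = inner v y" if v: "v \<in> S" for v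
  proof (cases "v = 0")
    case True
    then show ?thesis using scale[of 0 0] v by simp
  next
    case False
    define c where "c = inner v y - f v"
    \<comment> \<open>\<open>t\<close> minimises the quadratic polynomial \<open>q (y + t v)\<close>, whose minimum is \<open>q y - c\<^sup>2 / |v|\<^sup>2\<close>.\<close>
    define t where "t = - c / (norm v)\<^sup>2"
    have sq: "(norm (y + t *\<^sub>R v))\<^sup>2 = (norm y)\<^sup>2 + 2 * t * inner v y + t\<^sup>2 * (norm v)\<^sup>2"
      unfolding power2_norm_eq_inner
      by (simp add: inner_add_left inner_add_right inner_commute[of y v] power2_eq_square algebra_simps)
    have "q y \<le> q (y + t *\<^sub>R v)"
      using \<open>q y \<le> m\<close> m_le[of "y + t *\<^sub>R v"] S(1) y(1) v
      by (simp add: subspace_add subspace_scale)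
    also have "\<dots> = q y + 2 * t * c + t\<^sup>2 * (norm v)\<^sup>2"
      using add[of y "t *\<^sub>R v"] scale[of v t] S(1) y(1) v sq
      by (simp add: q_def c_def subspace_scale algebra_simps)
    also have "\<dots> = q y - c\<^sup>2 / (norm v)\<^sup>2"
      using False by (simp add: t_def power2_eq_square field_simps)
    finally have "c = 0" using False by (simp add: divide_le_0_iff)
    then show ?thesis by (simp add: c_def)
  qed
  then show ?thesis using y(1) by blast
qed

lemma cscale_real: "blinfun_apply (cscale (of_real r)) x = r *\<^sub>R x"
  by (rule ell2_eqI) (simp add: coord_cscale coord_scaleR scaleR_conv_of_real)

lemma cinner_cscale_right: "cinner x (blinfun_apply (cscale c) y) = c * cinner x y"
  unfolding cinner_def using suminf_mult[OF summable_cinner, of c x y]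
  by (simp add: coord_cscale mult.left_commute)

lemma cinner_commute: "cinner y x = cnj (cinner x y)"
proof -
  have "(\<lambda>n. cnj (coord x n) * coord y n) sums cinner x y"
    unfolding cinner_def by (rule summable_sums[OF summable_cinner])
  then have "(\<lambda>n. cnj (coord y n) * coord x n) sums cnj (cinner x y)"
    by (subst (asm) sums_cnj[symmetric]) (simp add: mult.commute)
  then show ?thesis unfolding cinner_def[of y x] by (rule sums_unique[symmetric])
qed

text \<open>
  The complex inner product is recovered from the real one, so that existence, uniqueness and
  linearity can be argued in the real inner product space.
\<close>

lemma cinner_eq_Complex:
  "cinner x y = Complex (inner x y) (- inner x (blinfun_apply (cscale \<i>) y))"
  by (simp add: complex_eq_iff inner_ell2_def cinner_cscale_right)

lemma cinner_eqI_of_inner: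
  assumes "inner x y = inner u v"
    and "inner x (blinfun_apply (cscale \<i>) y) = inner u (blinfun_apply (cscale \<i>) v)"
  shows "cinner x y = cinner u v"
  using assms by (simp add: cinner_eq_Complex)

lemma adj_unique:
  assumes "\<And>x y. cinner (blinfun_apply S x) y = cinner x (blinfun_apply T y)"
  shows "adj T = S"
  unfolding adj_def
proof (rule the_equality)
  fix S' assume S': "\<forall>x y. cinner (blinfun_apply S' x) y = cinner x (blinfun_apply T y)"
  show "S' = S"
  proof (rule blinfun_eqI)
    fix x
    have "inner (S' x) y = inner (S x) y" for y
      using S' assms by (simp add: inner_ell2_def)
    then show "S' x = S x" using vector_eq_rdot by blast
  qed
qed (use assms in blast)

text \<open>
  The Riesz theorem for the real inner product gives a real adjoint; as \<open>T\<close> commutes with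
  multiplication by \<open>\<i>\<close>, it is also the adjoint for the complex inner product.
\<close>

lemma cinner_adj:
  assumes "T \<in> bounded_ops"
  shows "cinner (blinfun_apply (adj T) x) y = cinner x (blinfun_apply T y)"
proof -
  have "\<exists>z. \<forall>y. inner x (T y) = inner y z" for x
  proof -
    have "\<bar>inner x (T y)\<bar> \<le> (norm x * norm T) * norm y" for y
    proof -
      have "\<bar>inner x (T y)\<bar> \<le> norm x * norm (T y)" by (rule Cauchy_Schwarz_ineq2)
      also have "\<dots> \<le> norm x * (norm T * norm y)" by (intro mult_left_mono norm_blinfun) auto
      finally show ?thesis by (simp add: mult.assoc)
    qed
    then show ?thesis
      using riesz_on_complete_subspace[of "UNIV :: ell2 set" "\<lambda>y. inner x (T y)"]
      by (auto simp: blinfun.bilinear_simps inner_add_right complete_UNIV)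
  qed
  then obtain F where F: "\<And>x y. inner x (T y) = inner y (F x)" by metis
  have bl: "bounded_linear F"
  proof (rule bounded_linear_intro[where K = "norm T"])
    show "F (x + y) = F x + F y" for x y
    proof -
      have "inner z (F (x + y)) = inner z (F x + F y)" for z
        by (simp add: F[symmetric] inner_add_left inner_add_right)
      then show ?thesis using vector_eq_ldot by blast
    qed
    show "F (r *\<^sub>R x) = r *\<^sub>R F x" for r x
    proof -
      have "inner z (F (r *\<^sub>R x)) = inner z (r *\<^sub>R F x)" for z
        by (simp add: F[symmetric])
      then show ?thesis using vector_eq_ldot by blast
    qed
    show "norm (F x) \<le> norm x * norm T" for x
    proof (cases "F x = 0")
      case False
      have "norm (F x) * norm (F x) = inner x (T (F x))"
        by (simp add: F power2_norm_eq_inner[symmetric] power2_eq_square)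
      also have "\<dots> \<le> norm x * norm (T (F x))" by (rule norm_cauchy_schwarz)
      also have "\<dots> \<le> norm x * (norm T * norm (F x))"
        by (intro mult_left_mono norm_blinfun) auto
      finally have "norm (F x) * norm (F x) \<le> (norm x * norm T) * norm (F x)"
        by (simp add: mult.assoc)
      then show ?thesis using False by simp
    qed simp
  qed
  have "cinner (blinfun_apply (Blinfun F) x) y = cinner x (blinfun_apply T y)" for x y
  proof (rule cinner_eqI_of_inner)
    have "T (cscale \<i> y) = cscale \<i> (T y)"
      using assms unfolding bounded_ops_def
      by (metis (mono_tags, lifting) blinfun_apply_blinfun_compose mem_Collect_eq)
    then show "inner (Blinfun F x) (cscale \<i> y) = inner x (cscale \<i> (T y))"
      using F[of x "cscale \<i> y"] by (simp add: bounded_linear_Blinfun_apply[OF bl] inner_commute)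
    show "inner (Blinfun F x) y = inner x (T y)"
      using F[of x y] by (simp add: bounded_linear_Blinfun_apply[OF bl] inner_commute)
  qed
  then show ?thesis using adj_unique by metis
qed

lemma adj_adj: "T \<in> bounded_ops \<Longrightarrow> adj (adj T) = T"
  by (rule adj_unique) (metis cinner_adj cinner_commute)

lemma cinner_cscale_left: "cinner (blinfun_apply (cscale c) x) y = cnj c * cinner x y"
  by (metis cinner_commute cinner_cscale_right complex_cnj_mult complex_cnj_cnj)

section \<open>Inner-product-preserving maps and commutants\<close>

lemma blinfun_compose_eqD: "S o\<^sub>L T = S' o\<^sub>L T' \<Longrightarrow> blinfun_apply S (blinfun_apply T x) = blinfun_apply S' (blinfun_apply T' x)"
  by (metis blinfun_apply_blinfun_compose)

lemma mem_commutant_iff: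
  "T \<in> commutant S \<longleftrightarrow>
     (\<forall>c x. blinfun_apply T (blinfun_apply (cscale c) x) = blinfun_apply (cscale c) (blinfun_apply T x)) \<and>
     (\<forall>s\<in>S. \<forall>x. blinfun_apply T (blinfun_apply s x) = blinfun_apply s (blinfun_apply T x))"
  by (auto simp: commutant_def bounded_ops_def dest: blinfun_compose_eqD intro!: blinfun_eqI)

lemma subspace_commutant: "subspace (commutant S)"
  by (rule subspaceI) (auto simp: mem_commutant_iff blinfun.bilinear_simps)

lemma compose_mem_commutant: "\<lbrakk>T \<in> commutant S; T' \<in> commutant S\<rbrakk> \<Longrightarrow> T o\<^sub>L T' \<in> commutant S"
  by (auto simp: mem_commutant_iff)

lemma cscale_compose_mem_commutant:
  assumes "T \<in> commutant S" "S \<subseteq> bounded_ops"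
  shows "cscale c o\<^sub>L T \<in> commutant S"
proof -
  have "cscale c (cscale d x) = cscale d (cscale c x)" for d x
    by (rule ell2_eqI) (simp add: coord_cscale)
  moreover have "s (cscale c x) = cscale c (s x)" if "s \<in> S" for s x
    using that assms(2) by (auto simp: bounded_ops_def dest: blinfun_compose_eqD)
  ultimately show ?thesis using assms(1) by (simp add: mem_commutant_iff)
qed

text \<open>
  Linearity comes for free: expanding \<open>|T (x + y) - T x - T y|\<^sup>2\<close> into inner products and removing \<open>T\<close>
  from each of them leaves \<open>|(x + y) - x - y|\<^sup>2 = 0\<close>.
\<close>

lemma inner_preserving_add:
  fixes T :: "'a::real_inner \<Rightarrow> 'b::real_inner"
  assumes S: "subspace S" and T: "\<And>x y. x \<in> S \<Longrightarrow> y \<in> S \<Longrightarrow> inner (T x) (T y) = inner x y"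
    and "x \<in> S" "y \<in> S"
  shows "T (x + y) = T x + T y"
proof -
  have "inner (T (x + y) - (T x + T y)) (T (x + y) - (T x + T y))
      = inner ((x + y) - (x + y)) ((x + y) - (x + y))"
    using assms(3,4) subspace_add[OF S assms(3,4)]
    by (simp only: inner_diff_left inner_diff_right inner_add_left inner_add_right T)
  then show ?thesis by simp
qed

lemma inner_preserving_scaleR:
  fixes T :: "'a::real_inner \<Rightarrow> 'b::real_inner"
  assumes S: "subspace S" and T: "\<And>x y. x \<in> S \<Longrightarrow> y \<in> S \<Longrightarrow> inner (T x) (T y) = inner x y"
    and "x \<in> S"
  shows "T (r *\<^sub>R x) = r *\<^sub>R T x"
proof -
  have "inner (T (r *\<^sub>R x) - r *\<^sub>R T x) (T (r *\<^sub>R x) - r *\<^sub>R T x)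
      = inner (r *\<^sub>R x - r *\<^sub>R x) (r *\<^sub>R x - r *\<^sub>R x)"
    using assms(3) subspace_scale[OF S assms(3)]
    by (simp add: inner_diff_left inner_diff_right T)
  then show ?thesis by simp
qed

text \<open>
  Multiplication by \<open>\<i>\<close>, through which the imaginary part of \<open>cinner_tuple\<close> becomes a real inner
  product.
\<close>

definition itimes :: "ell2 ^ 'd::finite \<Rightarrow> ell2 ^ 'd" where
  "itimes X = (\<chi> j. blinfun_apply (cscale \<i>) (X $ j))"

lemma cinner_tuple_eq_Complex: "cinner_tuple X P = Complex (inner X P) (inner (itimes X) P)"
  by (simp add: complex_eq_iff Re_cinner_tuple)
    (simp add: cinner_tuple_def inner_vec_def itimes_def inner_ell2_def cinner_cscale_left)

section \<open>The completion of one tracial algebra\<close>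

locale tracial_completion =
  fixes \<eta> :: model and A :: wstar
  assumes tracial: "tracial_wstar A" and model: "L2_model A (\<eta> A)"
begin

lemma car_eq_bicommutant: "car A = commutant (commutant (car A))"
  using tracial unfolding tracial_wstar_def von_neumann_algebra_def by simp

lemma car_bounded: "x \<in> car A \<Longrightarrow> x \<in> bounded_ops"
  by (subst (asm) car_eq_bicommutant) (simp add: commutant_def)

lemma subspace_car: "subspace (car A)"
  by (subst car_eq_bicommutant) (rule subspace_commutant)

lemma compose_in_car: "\<lbrakk>x \<in> car A; y \<in> car A\<rbrakk> \<Longrightarrow> x o\<^sub>L y \<in> car A"
  by (subst car_eq_bicommutant, rule compose_mem_commutant) (simp_all flip: car_eq_bicommutant)

lemma cscale_in_car: "x \<in> car A \<Longrightarrow> cscale c o\<^sub>L x \<in> car A"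
  by (subst car_eq_bicommutant, rule cscale_compose_mem_commutant)
    (simp_all flip: car_eq_bicommutant, simp add: commutant_def)

lemma adj_in_car: "x \<in> car A \<Longrightarrow> adj x \<in> car A"
  using tracial unfolding tracial_wstar_def von_neumann_algebra_def by simp

lemma tr_commute: "\<lbrakk>x \<in> car A; y \<in> car A\<rbrakk> \<Longrightarrow> tr A (x o\<^sub>L y) = tr A (y o\<^sub>L x)"
  using tracial by (simp add: tracial_wstar_def)

lemma \<eta>_add: "\<lbrakk>x \<in> car A; y \<in> car A\<rbrakk> \<Longrightarrow> \<eta> A (x + y) = \<eta> A x + \<eta> A y"
  and \<eta>_cscale: "x \<in> car A \<Longrightarrow> \<eta> A (cscale c o\<^sub>L x) = blinfun_apply (cscale c) (\<eta> A x)"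
  and cinner_\<eta>: "\<lbrakk>x \<in> car A; y \<in> car A\<rbrakk> \<Longrightarrow> cinner (\<eta> A x) (\<eta> A y) = tr A (adj x o\<^sub>L y)"
  using model unfolding L2_model_def by auto

lemma \<eta>_scaleR:
  assumes "x \<in> car A"
  shows "\<eta> A (r *\<^sub>R x) = r *\<^sub>R \<eta> A x"
proof -
  have "r *\<^sub>R x = cscale (of_real r) o\<^sub>L x"
    by (rule blinfun_eqI) (simp add: cscale_real scaleR_blinfun.rep_eq)
  then show ?thesis using \<eta>_cscale[OF assms, of "of_real r"] by (simp add: cscale_real)
qed

lemma L2_sequence:
  assumes "\<xi> \<in> L2 \<eta> A"
  obtains x where "\<And>n. x n \<in> car A" "(\<lambda>n. \<eta> A (x n)) \<longlonglongrightarrow> \<xi>"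
proof -
  obtain u where u: "\<And>n. u n \<in> \<eta> A ` car A" "u \<longlonglongrightarrow> \<xi>"
    using assms unfolding L2_def closure_sequential by blast
  then have "\<forall>n. \<exists>x. x \<in> car A \<and> u n = \<eta> A x" by blast
  then obtain x where x: "\<And>n. x n \<in> car A \<and> u n = \<eta> A (x n)" by metis
  then have "u = (\<lambda>n. \<eta> A (x n))" by auto
  then show ?thesis using that x u(2) by blast
qed

lemma L2_limit: "\<lbrakk>\<And>n. x n \<in> car A; (\<lambda>n. \<eta> A (x n)) \<longlonglongrightarrow> \<xi>\<rbrakk> \<Longrightarrow> \<xi> \<in> L2 \<eta> A"
  unfolding L2_def closure_sequential by (intro exI[of _ "\<lambda>n. \<eta> A (x n)"]) auto

lemma closed_L2: "closed (L2 \<eta> A)"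
  by (simp add: L2_def)

lemma subspace_L2: "subspace (L2 \<eta> A)"
proof (rule subspaceI)
  have "\<eta> A 0 = 0" using \<eta>_scaleR[OF subspace_0[OF subspace_car], of 0] by simp
  then show "0 \<in> L2 \<eta> A"
    using subspace_0[OF subspace_car] by (intro L2_limit[of "\<lambda>_. 0"]) auto
  fix \<xi> \<zeta> assume \<xi>: "\<xi> \<in> L2 \<eta> A" and \<zeta>: "\<zeta> \<in> L2 \<eta> A"
  obtain x where x: "\<And>n. x n \<in> car A" "(\<lambda>n. \<eta> A (x n)) \<longlonglongrightarrow> \<xi>"
    using L2_sequence[OF \<xi>] by blast
  obtain y where y: "\<And>n. y n \<in> car A" "(\<lambda>n. \<eta> A (y n)) \<longlonglongrightarrow> \<zeta>"
    using L2_sequence[OF \<zeta>] by blast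
  show "\<xi> + \<zeta> \<in> L2 \<eta> A"
  proof (rule L2_limit)
    show "x n + y n \<in> car A" for n by (intro subspace_add subspace_car x y)
    show "(\<lambda>n. \<eta> A (x n + y n)) \<longlonglongrightarrow> \<xi> + \<zeta>"
      unfolding \<eta>_add[OF x(1) y(1)] by (intro tendsto_intros x y)
  qed
next
  fix r \<xi> assume "\<xi> \<in> L2 \<eta> A"
  then obtain x where x: "\<And>n. x n \<in> car A" "(\<lambda>n. \<eta> A (x n)) \<longlonglongrightarrow> \<xi>"
    using L2_sequence by blast
  show "r *\<^sub>R \<xi> \<in> L2 \<eta> A"
  proof (rule L2_limit)
    show "r *\<^sub>R x n \<in> car A" for n by (intro subspace_scale subspace_car x)
    show "(\<lambda>n. \<eta> A (r *\<^sub>R x n)) \<longlonglongrightarrow> r *\<^sub>R \<xi>"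
      unfolding \<eta>_scaleR[OF x(1)] by (intro tendsto_intros x)
  qed
qed

lemma cscale_in_L2:
  assumes "\<xi> \<in> L2 \<eta> A"
  shows "blinfun_apply (cscale c) \<xi> \<in> L2 \<eta> A"
proof -
  obtain x where x: "\<And>n. x n \<in> car A" "(\<lambda>n. \<eta> A (x n)) \<longlonglongrightarrow> \<xi>"
    using L2_sequence[OF assms] by blast
  show ?thesis
  proof (rule L2_limit)
    show "cscale c o\<^sub>L x n \<in> car A" for n by (intro cscale_in_car x)
    show "(\<lambda>n. \<eta> A (cscale c o\<^sub>L x n)) \<longlonglongrightarrow> blinfun_apply (cscale c) \<xi>"
      unfolding \<eta>_cscale[OF x(1)] by (intro tendsto_intros x)
  qed
qed

text \<open>
  If \<open>f\<close> preserves inner products, it preserves distances, so images of sequences with a common limit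
  in \<open>L\<^sup>2\<close> are Cauchy and share their limit. Therefore the defining description of \<open>L2_extend\<close>
  denotes.
\<close>

lemma L2_extend_tendsto:
  assumes f: "\<And>x y. x \<in> car A \<Longrightarrow> y \<in> car A \<Longrightarrow> inner (f x) (f y) = inner (\<eta> A x) (\<eta> A y)"
    and x: "\<And>n. x n \<in> car A" "(\<lambda>n. \<eta> A (x n)) \<longlonglongrightarrow> \<xi>"
  shows "(\<lambda>n. f (x n)) \<longlonglongrightarrow> L2_extend \<eta> A f \<xi>"
proof -
  have iso: "norm (f u - f v) = norm (\<eta> A u - \<eta> A v)" if "u \<in> car A" "v \<in> car A" for u v
    using that by (simp add: norm_eq_sqrt_inner inner_diff_left inner_diff_right f)
  have "Cauchy (\<lambda>n. f (x n))"
    using LIMSEQ_imp_Cauchy[OF x(2)] unfolding Cauchy_iff by (simp add: iso x(1))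
  then obtain \<zeta> where \<zeta>: "(\<lambda>n. f (x n)) \<longlonglongrightarrow> \<zeta>"
    using Cauchy_convergent_iff convergent_def by blast
  have all: "(\<lambda>n. f (y n)) \<longlonglongrightarrow> \<zeta>"
    if y: "\<forall>n. y n \<in> car A" "(\<lambda>n. \<eta> A (y n)) \<longlonglongrightarrow> \<xi>" for y
  proof -
    have "(\<lambda>n. \<eta> A (y n) - \<eta> A (x n)) \<longlonglongrightarrow> 0"
      using tendsto_diff[OF y(2) x(2)] by simp
    then have "(\<lambda>n. f (y n) - f (x n)) \<longlonglongrightarrow> 0"
      by (subst (asm) tendsto_norm_zero_iff[symmetric], subst tendsto_norm_zero_iff[symmetric])
        (simp add: iso x(1) y(1))
    from tendsto_add[OF this \<zeta>] show ?thesis by simp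
  qed
  have "L2_extend \<eta> A f \<xi> = \<zeta>"
    unfolding L2_extend_def
  proof (rule the_equality)
    show "\<zeta>' = \<zeta>"
      if "\<forall>y. (\<forall>n. y n \<in> car A) \<and> (\<lambda>n. \<eta> A (y n)) \<longlonglongrightarrow> \<xi> \<longrightarrow> (\<lambda>n. f (y n)) \<longlonglongrightarrow> \<zeta>'" for \<zeta>'
      using that x \<zeta> LIMSEQ_unique by blast
  qed (use all in blast)
  then show ?thesis using \<zeta> by simp
qed

lemma L2_extend_inner:
  assumes f: "\<And>x y. x \<in> car A \<Longrightarrow> y \<in> car A \<Longrightarrow> inner (f x) (f y) = inner (\<eta> A x) (\<eta> A y)"
    and "\<xi> \<in> L2 \<eta> A" "\<zeta> \<in> L2 \<eta> A"
  shows "inner (L2_extend \<eta> A f \<xi>) (L2_extend \<eta> A f \<zeta>) = inner \<xi> \<zeta>"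
proof -
  obtain x where x: "\<And>n. x n \<in> car A" "(\<lambda>n. \<eta> A (x n)) \<longlonglongrightarrow> \<xi>"
    using L2_sequence[OF assms(2)] by blast
  obtain y where y: "\<And>n. y n \<in> car A" "(\<lambda>n. \<eta> A (y n)) \<longlonglongrightarrow> \<zeta>"
    using L2_sequence[OF assms(3)] by blast
  have "(\<lambda>n. inner (f (x n)) (f (y n))) \<longlonglongrightarrow> inner (L2_extend \<eta> A f \<xi>) (L2_extend \<eta> A f \<zeta>)"
    by (intro tendsto_intros L2_extend_tendsto f x y)
  moreover have "(\<lambda>n. inner (f (x n)) (f (y n))) \<longlonglongrightarrow> inner \<xi> \<zeta>"
    unfolding f[OF x(1) y(1)] by (intro tendsto_intros x y)
  ultimately show ?thesis by (rule LIMSEQ_unique)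
qed

text \<open>
  Only the real part survives: by the trace property, \<open>\<langle>x\<^sup>*, y\<^sup>*\<rangle> = \<tau>(x y\<^sup>*) = \<tau>(y\<^sup>* x) = \<langle>y, x\<rangle>\<close>, the
  conjugate of \<open>\<langle>x, y\<rangle>\<close>.
\<close>

lemma inner_\<eta>_adj:
  assumes "x \<in> car A" "y \<in> car A"
  shows "inner (\<eta> A (adj x)) (\<eta> A (adj y)) = inner (\<eta> A x) (\<eta> A y)"
proof -
  have "cinner (\<eta> A (adj x)) (\<eta> A (adj y)) = tr A (x o\<^sub>L adj y)"
    using assms by (simp add: cinner_\<eta> adj_in_car adj_adj car_bounded)
  also have "\<dots> = tr A (adj y o\<^sub>L x)"
    by (rule tr_commute[OF assms(1) adj_in_car[OF assms(2)]])
  also have "\<dots> = cinner (\<eta> A y) (\<eta> A x)" using assms by (simp add: cinner_\<eta>)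
  finally show ?thesis by (simp add: inner_ell2_def cinner_commute[of "\<eta> A y"])
qed

lemma L2_adj_tendsto:
  assumes "\<And>n. x n \<in> car A" "(\<lambda>n. \<eta> A (x n)) \<longlonglongrightarrow> \<xi>"
  shows "(\<lambda>n. \<eta> A (adj (x n))) \<longlonglongrightarrow> L2_adj \<eta> A \<xi>"
  unfolding L2_adj_def by (intro L2_extend_tendsto inner_\<eta>_adj assms)

lemma inner_L2_adj_both:
  assumes "\<xi> \<in> L2 \<eta> A" "\<zeta> \<in> L2 \<eta> A"
  shows "inner (L2_adj \<eta> A \<xi>) (L2_adj \<eta> A \<zeta>) = inner \<xi> \<zeta>"
  unfolding L2_adj_def by (intro L2_extend_inner inner_\<eta>_adj assms)

lemma L2_adj_in_L2:
  assumes "\<xi> \<in> L2 \<eta> A"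
  shows "L2_adj \<eta> A \<xi> \<in> L2 \<eta> A"
proof -
  obtain x where x: "\<And>n. x n \<in> car A" "(\<lambda>n. \<eta> A (x n)) \<longlonglongrightarrow> \<xi>"
    using L2_sequence[OF assms] by blast
  show ?thesis by (rule L2_limit[OF adj_in_car[OF x(1)] L2_adj_tendsto[OF x]])
qed

lemma L2_adj_involutive:
  assumes "\<xi> \<in> L2 \<eta> A"
  shows "L2_adj \<eta> A (L2_adj \<eta> A \<xi>) = \<xi>"
proof -
  obtain x where x: "\<And>n. x n \<in> car A" "(\<lambda>n. \<eta> A (x n)) \<longlonglongrightarrow> \<xi>"
    using L2_sequence[OF assms] by blast
  have "(\<lambda>n. \<eta> A (adj (adj (x n)))) \<longlonglongrightarrow> L2_adj \<eta> A (L2_adj \<eta> A \<xi>)"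
    by (intro L2_adj_tendsto adj_in_car x)
  then have "(\<lambda>n. \<eta> A (x n)) \<longlonglongrightarrow> L2_adj \<eta> A (L2_adj \<eta> A \<xi>)"
    by (simp add: adj_adj car_bounded x(1))
  then show ?thesis using x(2) LIMSEQ_unique by blast
qed

lemma subspace_L2d: "subspace (L2d \<eta> A)"
  using subspace_L2 by (auto simp: L2d_def subspace_def)

lemma complete_L2d: "complete (L2d \<eta> A :: (ell2 ^ 'd::finite) set)"
proof -
  have "L2d \<eta> A = (\<Inter>j. (\<lambda>X :: ell2 ^ 'd. X $ j) -` L2 \<eta> A)"
    by (auto simp: L2d_def)
  moreover have "closed \<dots>"
    by (intro closed_INT ballI closed_vimage closed_L2 continuous_on_component continuous_on_id)
  ultimately show ?thesis by (simp add: complete_eq_closed)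
qed

lemma subspace_L2d_sa: "subspace (L2d_sa \<eta> A)"
proof -
  have add: "L2_adj \<eta> A (\<xi> + \<zeta>) = L2_adj \<eta> A \<xi> + L2_adj \<eta> A \<zeta>"
    if "\<xi> \<in> L2 \<eta> A" "\<zeta> \<in> L2 \<eta> A" for \<xi> \<zeta>
    by (rule inner_preserving_add[OF subspace_L2 _ that]) (rule inner_L2_adj_both)
  have scale: "L2_adj \<eta> A (r *\<^sub>R \<xi>) = r *\<^sub>R L2_adj \<eta> A \<xi>" if "\<xi> \<in> L2 \<eta> A" for r \<xi>
    by (rule inner_preserving_scaleR[OF subspace_L2 _ that]) (rule inner_L2_adj_both)
  have "L2_adj \<eta> A 0 = 0" using scale[OF subspace_0[OF subspace_L2], of 0] by simp
  then show ?thesis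
    using subspace_L2 by (auto simp: L2d_sa_def subspace_def add scale)
qed

lemma L2d_sa_subset: "L2d_sa \<eta> A \<subseteq> L2d \<eta> A"
  by (auto simp: L2d_sa_def L2d_def)

end

section \<open>Embeddings and conditional expectations\<close>

locale completed_embedding =
  dom: tracial_completion \<eta> A + cod: tracial_completion \<eta> B for \<eta> A B +
  fixes \<iota> :: "op \<Rightarrow> op"
  assumes embedding: "wstar_embedding A B \<iota>"
begin

abbreviation ext :: "ell2 \<Rightarrow> ell2" where
  "ext \<equiv> L2_extend \<eta> A (\<lambda>x. \<eta> B (\<iota> x))"

abbreviation emb :: "ell2 ^ 'd::finite \<Rightarrow> ell2 ^ 'd" where
  "emb \<equiv> emb_tuple \<eta> A B \<iota>"

abbreviation E :: "ell2 ^ 'd::finite \<Rightarrow> ell2 ^ 'd" where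
  "E \<equiv> cond_exp \<eta> A B \<iota>"

lemma \<iota>_in_car: "x \<in> car A \<Longrightarrow> \<iota> x \<in> car B"
  using embedding unfolding wstar_embedding_def by blast

lemma \<iota>_compose: "\<lbrakk>x \<in> car A; y \<in> car A\<rbrakk> \<Longrightarrow> \<iota> (x o\<^sub>L y) = \<iota> x o\<^sub>L \<iota> y"
  and \<iota>_cscale: "x \<in> car A \<Longrightarrow> \<iota> (cscale c o\<^sub>L x) = cscale c o\<^sub>L \<iota> x"
  and \<iota>_adj: "x \<in> car A \<Longrightarrow> \<iota> (adj x) = adj (\<iota> x)"
  and tr_\<iota>: "x \<in> car A \<Longrightarrow> tr B (\<iota> x) = tr A x"
  using embedding by (simp_all add: wstar_embedding_def)

lemma inner_\<eta>_\<iota>: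
  assumes "x \<in> car A" "y \<in> car A"
  shows "inner (\<eta> B (\<iota> x)) (\<eta> B (\<iota> y)) = inner (\<eta> A x) (\<eta> A y)"
proof -
  have ax: "adj x \<in> car A" by (rule dom.adj_in_car[OF assms(1)])
  have "cinner (\<eta> B (\<iota> x)) (\<eta> B (\<iota> y)) = tr B (adj (\<iota> x) o\<^sub>L \<iota> y)"
    using assms by (simp add: cod.cinner_\<eta> \<iota>_in_car)
  also have "\<dots> = tr B (\<iota> (adj x o\<^sub>L y))"
    by (simp add: assms ax \<iota>_compose \<iota>_adj)
  also have "\<dots> = tr A (adj x o\<^sub>L y)"
    by (rule tr_\<iota>[OF dom.compose_in_car[OF ax assms(2)]])
  also have "\<dots> = cinner (\<eta> A x) (\<eta> A y)" using assms by (simp add: dom.cinner_\<eta>)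
  finally show ?thesis by (simp add: inner_ell2_def)
qed

lemma ext_tendsto:
  assumes "\<And>n. x n \<in> car A" "(\<lambda>n. \<eta> A (x n)) \<longlonglongrightarrow> \<xi>"
  shows "(\<lambda>n. \<eta> B (\<iota> (x n))) \<longlonglongrightarrow> ext \<xi>"
  by (intro dom.L2_extend_tendsto inner_\<eta>_\<iota> assms)

lemma inner_ext: "\<lbrakk>\<xi> \<in> L2 \<eta> A; \<zeta> \<in> L2 \<eta> A\<rbrakk> \<Longrightarrow> inner (ext \<xi>) (ext \<zeta>) = inner \<xi> \<zeta>"
  by (intro dom.L2_extend_inner inner_\<eta>_\<iota>)

lemma ext_in_L2:
  assumes "\<xi> \<in> L2 \<eta> A"
  shows "ext \<xi> \<in> L2 \<eta> B"
proof -
  obtain x where x: "\<And>n. x n \<in> car A" "(\<lambda>n. \<eta> A (x n)) \<longlonglongrightarrow> \<xi>"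
    using dom.L2_sequence[OF assms] by blast
  show ?thesis by (rule cod.L2_limit[OF \<iota>_in_car[OF x(1)] ext_tendsto[OF x]])
qed

lemma ext_cscale:
  assumes "\<xi> \<in> L2 \<eta> A"
  shows "ext (blinfun_apply (cscale c) \<xi>) = blinfun_apply (cscale c) (ext \<xi>)"
proof -
  obtain x where x: "\<And>n. x n \<in> car A" "(\<lambda>n. \<eta> A (x n)) \<longlonglongrightarrow> \<xi>"
    using dom.L2_sequence[OF assms] by blast
  have "(\<lambda>n. \<eta> A (cscale c o\<^sub>L x n)) \<longlonglongrightarrow> blinfun_apply (cscale c) \<xi>"
    unfolding dom.\<eta>_cscale[OF x(1)] by (intro tendsto_intros x)
  then have "(\<lambda>n. \<eta> B (\<iota> (cscale c o\<^sub>L x n))) \<longlonglongrightarrow> ext (blinfun_apply (cscale c) \<xi>)"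
    by (intro ext_tendsto dom.cscale_in_car x)
  moreover have "\<eta> B (\<iota> (cscale c o\<^sub>L x n)) = blinfun_apply (cscale c) (\<eta> B (\<iota> (x n)))" for n
    by (simp add: x(1) \<iota>_cscale cod.\<eta>_cscale \<iota>_in_car)
  moreover have "(\<lambda>n. blinfun_apply (cscale c) (\<eta> B (\<iota> (x n)))) \<longlonglongrightarrow> blinfun_apply (cscale c) (ext \<xi>)"
    by (intro tendsto_intros ext_tendsto x)
  ultimately show ?thesis using LIMSEQ_unique by simp
qed

lemma ext_L2_adj:
  assumes "\<xi> \<in> L2 \<eta> A"
  shows "ext (L2_adj \<eta> A \<xi>) = L2_adj \<eta> B (ext \<xi>)"
proof -
  obtain x where x: "\<And>n. x n \<in> car A" "(\<lambda>n. \<eta> A (x n)) \<longlonglongrightarrow> \<xi>"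
    using dom.L2_sequence[OF assms] by blast
  have "(\<lambda>n. \<eta> B (\<iota> (adj (x n)))) \<longlonglongrightarrow> ext (L2_adj \<eta> A \<xi>)"
    by (intro ext_tendsto dom.adj_in_car dom.L2_adj_tendsto x)
  moreover have "\<iota> (adj (x n)) = adj (\<iota> (x n))" for n
    by (rule \<iota>_adj[OF x(1)])
  moreover have "(\<lambda>n. \<eta> B (adj (\<iota> (x n)))) \<longlonglongrightarrow> L2_adj \<eta> B (ext \<xi>)"
    by (intro cod.L2_adj_tendsto ext_tendsto \<iota>_in_car x)
  ultimately show ?thesis using LIMSEQ_unique by simp
qed

lemma emb_nth: "emb X $ j = ext (X $ j)"
  by (simp add: emb_tuple_def)

lemma inner_emb: "\<lbrakk>X \<in> L2d \<eta> A; Y \<in> L2d \<eta> A\<rbrakk> \<Longrightarrow> inner (emb X) (emb Y) = inner X Y"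
  by (simp add: inner_vec_def emb_nth L2d_def inner_ext)

lemma emb_sa: "X \<in> L2d_sa \<eta> A \<Longrightarrow> emb X \<in> L2d_sa \<eta> B"
  by (simp add: L2d_sa_def emb_nth ext_in_L2 flip: ext_L2_adj)

lemma itimes_in_L2d: "X \<in> L2d \<eta> A \<Longrightarrow> itimes X \<in> L2d \<eta> A"
  by (simp add: L2d_def itimes_def dom.cscale_in_L2)

lemma emb_itimes: "X \<in> L2d \<eta> A \<Longrightarrow> emb (itimes X) = itimes (emb X)"
  by (simp add: vec_eq_iff emb_nth itimes_def L2d_def ext_cscale)

text \<open>
  It is enough to test the adjoint relation with the real inner product, because \<open>emb\<close> commutes with
  multiplication by \<open>\<i>\<close>.
\<close>

lemma cond_exp_unique:
  assumes "Q \<in> L2d \<eta> A" and Q: "\<And>X. X \<in> L2d \<eta> A \<Longrightarrow> inner (emb X) P = inner X Q"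
  shows "E P = Q"
  unfolding cond_exp_def
proof (rule the_equality)
  show "Q \<in> L2d \<eta> A \<and> (\<forall>X\<in>L2d \<eta> A. cinner_tuple (emb X) P = cinner_tuple X Q)"
    using assms by (simp add: cinner_tuple_eq_Complex itimes_in_L2d flip: emb_itimes)
  fix Q' assume Q': "Q' \<in> L2d \<eta> A \<and> (\<forall>X\<in>L2d \<eta> A. cinner_tuple (emb X) P = cinner_tuple X Q')"
  then have d: "Q' - Q \<in> L2d \<eta> A" using assms(1) by (simp add: subspace_diff dom.subspace_L2d)
  have "inner (Q' - Q) Q' = inner (Q' - Q) Q"
    using Q' d Q[OF d] by (simp add: cinner_tuple_eq_Complex)
  then have "inner (Q' - Q) (Q' - Q) = 0" by (simp add: inner_diff_right)
  then show "Q' = Q" by simp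
qed

lemma cond_exp_adjoint:
  fixes P :: "ell2 ^ 'd::finite"
  shows cond_exp_in_L2d: "E P \<in> L2d \<eta> A"
    and inner_cond_exp: "X \<in> L2d \<eta> A \<Longrightarrow> inner (emb X) P = inner X (E P)"
proof -
  have norm_emb: "norm (emb X) = norm X" if "X \<in> L2d \<eta> A" for X :: "ell2 ^ 'd"
    using that by (simp add: norm_eq_sqrt_inner inner_emb)
  have "\<exists>Q\<in>L2d \<eta> A. \<forall>X\<in>L2d \<eta> A. inner (emb X) P = inner X Q"
  proof (rule riesz_on_complete_subspace[OF dom.subspace_L2d dom.complete_L2d])
    fix X Y :: "ell2 ^ 'd" and r :: real assume X: "X \<in> L2d \<eta> A"
    show "inner (emb (r *\<^sub>R X)) P = r * inner (emb X) P"
      by (simp add: inner_preserving_scaleR[OF dom.subspace_L2d _ X] inner_emb)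
    have "\<bar>inner (emb X) P\<bar> \<le> norm (emb X) * norm P" by (rule Cauchy_Schwarz_ineq2)
    then show "\<bar>inner (emb X) P\<bar> \<le> norm P * norm X" using X by (simp add: norm_emb mult.commute)
    assume "Y \<in> L2d \<eta> A"
    then show "inner (emb (X + Y)) P = inner (emb X) P + inner (emb Y) P"
      by (simp add: inner_preserving_add[OF dom.subspace_L2d _ X] inner_emb inner_add_left)
  qed
  then obtain Q where "Q \<in> L2d \<eta> A" "\<And>X. X \<in> L2d \<eta> A \<Longrightarrow> inner (emb X) P = inner X Q" by blast
  moreover from this have "E P = Q" by (rule cond_exp_unique)
  ultimately show "E P \<in> L2d \<eta> A" "X \<in> L2d \<eta> A \<Longrightarrow> inner (emb X) P = inner X (E P)" by simp_all
qed

lemma cond_exp_emb: "X \<in> L2d \<eta> A \<Longrightarrow> E (emb X) = X"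
  by (rule cond_exp_unique) (auto simp: inner_emb)

text \<open>
  The involution \<open>J\<close> of \<open>L\<^sup>2(A)\<^sup>d\<close> is symmetric for the real inner product and intertwined with that of
  \<open>L\<^sup>2(B)\<^sup>d\<close> by \<open>emb\<close>. So if \<open>P\<close> is self-adjoint, \<open>J (E P)\<close> satisfies the relation that characterises
  \<open>E P\<close>.
\<close>

lemma cond_exp_sa:
  fixes P :: "ell2 ^ 'd::finite"
  assumes "P \<in> L2d_sa \<eta> B"
  shows "E P \<in> L2d_sa \<eta> A"
proof -
  define J where "J X = (\<chi> j. L2_adj \<eta> A (X $ j))" for X :: "ell2 ^ 'd"
  have J: "J X \<in> L2d \<eta> A" "J (J X) = X" if "X \<in> L2d \<eta> A" for X
    using that by (simp_all add: J_def L2d_def dom.L2_adj_in_L2 dom.L2_adj_involutive)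
  have inner_J: "inner X (J Y) = inner (J X) Y" if X: "X \<in> L2d \<eta> A" and Y: "Y \<in> L2d \<eta> A" for X Y
  proof -
    have "inner (J (J X)) (J Y) = inner (J X) Y"
      using J(1)[OF X] Y unfolding J_def[of Y] J_def[of "J X"]
      by (simp add: inner_vec_def L2d_def dom.inner_L2_adj_both)
    then show ?thesis by (simp add: J(2)[OF X])
  qed
  have "E P = J (E P)"
  proof (rule cond_exp_unique)
    show "J (E P) \<in> L2d \<eta> A" by (intro J cond_exp_in_L2d)
    fix X :: "ell2 ^ 'd" assume X: "X \<in> L2d \<eta> A"
    have "inner X (J (E P)) = inner (emb (J X)) P"
      by (simp add: inner_J X J cond_exp_in_L2d inner_cond_exp)
    also have "\<dots> = (\<Sum>j\<in>UNIV. inner (L2_adj \<eta> B (ext (X $ j))) (P $ j))"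
      using X by (simp add: inner_vec_def emb_nth J_def L2d_def ext_L2_adj)
    also have "\<dots> = (\<Sum>j\<in>UNIV. inner (ext (X $ j)) (P $ j))"
    proof (rule sum.cong)
      fix j
      have "ext (X $ j) \<in> L2 \<eta> B" "P $ j \<in> L2 \<eta> B" "L2_adj \<eta> B (P $ j) = P $ j"
        using X assms by (auto simp: L2d_def L2d_sa_def ext_in_L2)
      then show "inner (L2_adj \<eta> B (ext (X $ j))) (P $ j) = inner (ext (X $ j)) (P $ j)"
        using cod.inner_L2_adj_both by metis
    qed simp
    also have "\<dots> = inner (emb X) P"
      by (simp add: inner_vec_def emb_nth)
    finally show "inner (emb X) P = inner X (J (E P))" by simp
  qed
  then have "E P $ j = L2_adj \<eta> A (E P $ j)" for j
    unfolding J_def by (metis vec_lambda_beta)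
  then show ?thesis using cond_exp_in_L2d[of P] by (simp add: L2d_sa_def L2d_def)
qed

end

context tracial_completion
begin

lemma wstar_embedding_id: "wstar_embedding A A id"
  by (simp add: wstar_embedding_def)

end

section \<open>The Hamiltonian of a control problem on a real inner product space\<close>

definition running_gain ::
  "('a::real_inner \<Rightarrow> 'a \<Rightarrow> 'a) \<Rightarrow> ('a \<Rightarrow> 'a \<Rightarrow> real) \<Rightarrow> 'a \<Rightarrow> 'a \<Rightarrow> 'a \<Rightarrow> real" where
  "running_gain b L X P \<alpha> = inner (b X \<alpha>) P - L X \<alpha>"

definition best_gain ::
  "'a::real_inner set \<Rightarrow> ('a \<Rightarrow> 'a \<Rightarrow> 'a) \<Rightarrow> ('a \<Rightarrow> 'a \<Rightarrow> real) \<Rightarrow> 'a \<Rightarrow> 'a \<Rightarrow> real" where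
  "best_gain U b L X P = (SUP \<alpha>\<in>U. running_gain b L X P \<alpha>)"

text \<open>
  States range over \<open>D\<close> and controls over \<open>U\<close>; momenta are arbitrary. The bound on the drift is asked
  only for controls in the unit ball, since affinity propagates it.
\<close>

locale control_system =
  fixes D U :: "'a::real_inner set"
    and b :: "'a \<Rightarrow> 'a \<Rightarrow> 'a" and L :: "'a \<Rightarrow> 'a \<Rightarrow> real"
    and Cbar C\<^sub>1 C\<^sub>2 :: real
  assumes convex_U: "convex U" and zero_U: "0 \<in> U"
    and drift_affine: "\<lbrakk>X \<in> D; \<alpha> \<in> U; \<beta> \<in> U; t \<in> {0..1}\<rbrakk> \<Longrightarrow>
          b X ((1 - t) *\<^sub>R \<alpha> + t *\<^sub>R \<beta>) = (1 - t) *\<^sub>R b X \<alpha> + t *\<^sub>R b X \<beta>"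
    and drift_bounded: "\<exists>K. \<forall>X\<in>D. \<forall>\<alpha>\<in>U. norm X \<le> R \<longrightarrow> norm \<alpha> \<le> 1 \<longrightarrow> norm (b X \<alpha>) \<le> K"
    and drift_lipschitz: "\<lbrakk>X \<in> D; Y \<in> D; \<alpha> \<in> U\<rbrakk> \<Longrightarrow> norm (b X \<alpha> - b Y \<alpha>) \<le> Cbar * norm (X - Y)"
    and Cbar_pos: "Cbar > 0" and C1_pos: "C\<^sub>1 > 0" and C2_pos: "C\<^sub>2 > 0"
    and cost_lower: "\<lbrakk>X \<in> D; \<alpha> \<in> U\<rbrakk> \<Longrightarrow> - C\<^sub>1 + 1 / C\<^sub>1 * (norm \<alpha>)\<^sup>2 \<le> L X \<alpha>"
    and cost_at_0: "X \<in> D \<Longrightarrow> L X 0 \<le> C\<^sub>1 * (1 + norm X)"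
    and cost_lipschitz: "\<lbrakk>X \<in> D; Y \<in> D; \<alpha> \<in> U\<rbrakk> \<Longrightarrow> \<bar>L X \<alpha> - L Y \<alpha>\<bar> \<le> C\<^sub>2 * norm (X - Y)"
begin

abbreviation gain :: "'a \<Rightarrow> 'a \<Rightarrow> 'a \<Rightarrow> real" where
  "gain \<equiv> running_gain b L"

abbreviation ham :: "'a \<Rightarrow> 'a \<Rightarrow> real" where
  "ham \<equiv> best_gain U b L"

text \<open>
  For \<open>n = |\<alpha>| > 1\<close> the control \<open>\<alpha> / n\<close> lies on the segment from \<open>0\<close> to \<open>\<alpha>\<close> and in the unit ball.
  Affinity gives \<open>b X \<alpha> = n b X (\<alpha> / n) - (n - 1) b X 0\<close>, which is of order \<open>n\<close>.
\<close>

lemma drift_growth: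
  "\<exists>K\<ge>0. \<forall>X\<in>D. \<forall>\<alpha>\<in>U. norm X \<le> R \<longrightarrow> norm (b X \<alpha>) \<le> K * (1 + norm \<alpha>)"
proof -
  obtain K0 where K0: "\<And>X \<alpha>. \<lbrakk>X \<in> D; \<alpha> \<in> U; norm X \<le> R; norm \<alpha> \<le> 1\<rbrakk> \<Longrightarrow> norm (b X \<alpha>) \<le> K0"
    using drift_bounded[of R] by blast
  define K where "K = max K0 0"
  have K: "\<lbrakk>X \<in> D; \<alpha> \<in> U; norm X \<le> R; norm \<alpha> \<le> 1\<rbrakk> \<Longrightarrow> norm (b X \<alpha>) \<le> K" "K \<ge> 0" for X \<alpha>
    using K0[of X \<alpha>] by (auto simp: K_def)
  have "norm (b X \<alpha>) \<le> 2 * K * (1 + norm \<alpha>)" if X: "X \<in> D" "norm X \<le> R" and \<alpha>: "\<alpha> \<in> U" for X \<alpha>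
  proof (cases "norm \<alpha> \<le> 1")
    case True
    have "K * 1 \<le> K * (2 * (1 + norm \<alpha>))" using K(2) by (intro mult_left_mono) auto
    then show ?thesis using K(1)[OF X(1) \<alpha> X(2) True] by (simp add: mult.assoc mult.left_commute)
  next
    case False
    define n where "n = norm \<alpha>"
    have n: "n > 1" using False by (simp add: n_def)
    let ?u = "(1 / n) *\<^sub>R \<alpha>"
    have u: "?u \<in> U"
      using convexD[OF convex_U zero_U \<alpha>, of "1 - 1/n" "1/n"] n by simp
    have "b X ?u = (1 - 1/n) *\<^sub>R b X 0 + (1/n) *\<^sub>R b X \<alpha>"
      using drift_affine[OF X(1) zero_U \<alpha>, of "1/n"] n by simp
    moreover have "n * (1 - 1 / n) = n - 1" using n by (simp add: field_simps)
    ultimately have "n *\<^sub>R b X ?u = (n - 1) *\<^sub>R b X 0 + b X \<alpha>"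
      using n by (simp add: scaleR_add_right)
    then have "b X \<alpha> = n *\<^sub>R b X ?u - (n - 1) *\<^sub>R b X 0" by simp
    then have "norm (b X \<alpha>) \<le> norm (n *\<^sub>R b X ?u) + norm ((n - 1) *\<^sub>R b X 0)"
      by (metis norm_triangle_ineq4)
    also have "\<dots> \<le> n * K + (n - 1) * K"
    proof (rule add_mono)
      have "norm ?u \<le> 1" using n by (simp add: n_def)
      then show "norm (n *\<^sub>R b X ?u) \<le> n * K" using n K(1)[OF X(1) u X(2)] by simp
      show "norm ((n - 1) *\<^sub>R b X 0) \<le> (n - 1) * K"
        using n K(1)[OF X(1) zero_U X(2)] by (simp add: mult_left_mono)
    qed
    also have "\<dots> \<le> 2 * K * (1 + norm \<alpha>)"
      using K(2) n by (simp add: n_def algebra_simps)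
    finally show ?thesis .
  qed
  then show ?thesis using K(2) by (intro exI[of _ "2 * K"]) auto
qed

text \<open>
  The gain is at most linear in \<open>|\<alpha>|\<close> minus \<open>|\<alpha>|\<^sup>2 / C\<^sub>1\<close>, so large controls can be made arbitrarily
  bad, uniformly over bounded sets of states and momenta.
\<close>

lemma gain_coercive:
  "\<exists>M. \<forall>X\<in>D. \<forall>P. \<forall>\<alpha>\<in>U. norm X \<le> R \<longrightarrow> norm P \<le> R \<longrightarrow> norm \<alpha> > M \<longrightarrow> gain X P \<alpha> \<le> m"
proof -
  obtain K where K: "K \<ge> 0" "\<And>X \<alpha>. \<lbrakk>X \<in> D; \<alpha> \<in> U; norm X \<le> R\<rbrakk> \<Longrightarrow> norm (b X \<alpha>) \<le> K * (1 + norm \<alpha>)"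
    using drift_growth by meson
  \<comment> \<open>Chosen such that \<open>|\<alpha>| > M\<close> forces both \<open>|\<alpha>| \<ge> 1\<close> and \<open>2 K |R| + C\<^sub>1 - |\<alpha>| / C\<^sub>1 \<le> - |m|\<close>.\<close>
  define M where "M = C\<^sub>1 * (2 * K * \<bar>R\<bar> + C\<^sub>1 + \<bar>m\<bar>) + 1"
  have "gain X P \<alpha> \<le> m"
    if X: "X \<in> D" "norm X \<le> R" and P: "norm P \<le> R" and \<alpha>: "\<alpha> \<in> U" and big: "norm \<alpha> > M" for X P \<alpha>
  proof -
    define a where "a = norm \<alpha>"
    have "0 \<le> C\<^sub>1 * (2 * K * \<bar>R\<bar> + C\<^sub>1 + \<bar>m\<bar>)" using K(1) C1_pos by simp
    then have a1: "a \<ge> 1" using big by (simp add: a_def M_def)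
    have "C\<^sub>1 * (2 * K * \<bar>R\<bar> + C\<^sub>1 + \<bar>m\<bar>) \<le> a" using big by (simp add: a_def M_def)
    then have aM: "2 * K * \<bar>R\<bar> + C\<^sub>1 + \<bar>m\<bar> \<le> a / C\<^sub>1"
      using C1_pos by (simp add: field_simps)
    have "inner (b X \<alpha>) P \<le> norm (b X \<alpha>) * norm P" by (rule norm_cauchy_schwarz)
    also have "\<dots> \<le> (K * (1 + a)) * \<bar>R\<bar>"
      using K X P \<alpha> a1 by (intro mult_mono) (auto simp: a_def)
    also have "\<dots> \<le> (K * (2 * a)) * \<bar>R\<bar>"
      using K(1) a1 by (intro mult_mono) auto
    finally have "gain X P \<alpha> \<le> K * (2 * a) * \<bar>R\<bar> + C\<^sub>1 - 1 / C\<^sub>1 * a\<^sup>2"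
      using cost_lower[OF X(1) \<alpha>] by (simp add: running_gain_def a_def)
    also have "\<dots> \<le> K * (2 * a) * \<bar>R\<bar> + C\<^sub>1 * a - 1 / C\<^sub>1 * a\<^sup>2"
      using C1_pos a1 by simp
    also have "\<dots> = a * ((2 * K * \<bar>R\<bar> + C\<^sub>1) - a / C\<^sub>1)"
      by (simp add: power2_eq_square algebra_simps)
    also have "\<dots> \<le> a * (- \<bar>m\<bar>)"
      using a1 aM by (intro mult_left_mono) auto
    also have "\<dots> \<le> m"
    proof -
      have "\<bar>m\<bar> * 1 \<le> \<bar>m\<bar> * a" using a1 by (intro mult_left_mono) auto
      then show ?thesis by (simp add: mult.commute)
    qed
    finally show ?thesis .
  qed
  then show ?thesis by blast
qed

text \<open>
  The momentum enters linearly through \<open>b Y \<alpha>\<close>, and this vector stays bounded as long as \<open>Y\<close> and \<open>\<alpha>\<close>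
  do.
\<close>

lemma gain_le_of_small_control:
  "\<exists>\<Lambda>\<ge>0. \<forall>Y\<in>D. \<forall>\<alpha>\<in>U. \<forall>P Q. norm Y \<le> R \<longrightarrow> norm \<alpha> \<le> M \<longrightarrow> gain Y P \<alpha> \<le> gain Y Q \<alpha> + \<Lambda> * norm (P - Q)"
proof -
  obtain K where K: "K \<ge> 0" "\<And>X \<alpha>. \<lbrakk>X \<in> D; \<alpha> \<in> U; norm X \<le> R\<rbrakk> \<Longrightarrow> norm (b X \<alpha>) \<le> K * (1 + norm \<alpha>)"
    using drift_growth by meson
  have "gain Y P \<alpha> \<le> gain Y Q \<alpha> + K * (1 + \<bar>M\<bar>) * norm (P - Q)"
    if "Y \<in> D" "\<alpha> \<in> U" "norm Y \<le> R" "norm \<alpha> \<le> M" for Y P Q \<alpha>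
  proof -
    have "gain Y P \<alpha> - gain Y Q \<alpha> = inner (b Y \<alpha>) (P - Q)"
      by (simp add: running_gain_def inner_diff_right)
    also have "\<dots> \<le> norm (b Y \<alpha>) * norm (P - Q)" by (rule norm_cauchy_schwarz)
    also have "\<dots> \<le> K * (1 + \<bar>M\<bar>) * norm (P - Q)"
    proof (intro mult_right_mono)
      have "K * (1 + norm \<alpha>) \<le> K * (1 + \<bar>M\<bar>)" using K(1) that by (intro mult_left_mono) auto
      then show "norm (b Y \<alpha>) \<le> K * (1 + \<bar>M\<bar>)" using K(2)[OF that(1,2,3)] by linarith
    qed simp
    finally show ?thesis by simp
  qed
  then show ?thesis using K(1) by (intro exI[of _ "K * (1 + \<bar>M\<bar>)"]) auto
qed

lemma bdd_above_gain:
  assumes "X \<in> D"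
  shows "bdd_above (gain X P ` U)"
proof -
  define R where "R = max (norm X) (norm P)"
  have R: "norm X \<le> R" "norm P \<le> R" by (auto simp: R_def)
  obtain M where M: "\<And>\<alpha>. \<lbrakk>\<alpha> \<in> U; norm \<alpha> > M\<rbrakk> \<Longrightarrow> gain X P \<alpha> \<le> 0"
    using gain_coercive[of R 0] assms R by meson
  obtain \<Lambda> where \<Lambda>: "\<Lambda> \<ge> 0" "\<And>\<alpha>. \<lbrakk>\<alpha> \<in> U; norm \<alpha> \<le> M\<rbrakk> \<Longrightarrow> gain X P \<alpha> \<le> gain X 0 \<alpha> + \<Lambda> * norm P"
    using gain_le_of_small_control[of R M] assms R(1) by (metis diff_zero)
  have "gain X P \<alpha> \<le> C\<^sub>1 + \<Lambda> * norm P" if "\<alpha> \<in> U" for \<alpha>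
  proof -
    have "0 \<le> 1 / C\<^sub>1 * (norm \<alpha>)\<^sup>2" using C1_pos by simp
    then have "gain X 0 \<alpha> \<le> C\<^sub>1" using cost_lower[OF assms that] unfolding running_gain_def by simp
    moreover have "0 \<le> C\<^sub>1 + \<Lambda> * norm P" using C1_pos \<Lambda>(1) by simp
    ultimately show ?thesis using M[OF that] \<Lambda>(2)[OF that] by (cases "norm \<alpha> > M") auto
  qed
  then show ?thesis by (rule bdd_aboveI2)
qed

lemma gain_le_ham: "\<lbrakk>X \<in> D; \<alpha> \<in> U\<rbrakk> \<Longrightarrow> gain X P \<alpha> \<le> ham X P"
  unfolding best_gain_def by (intro cSUP_upper bdd_above_gain)

lemma ham_le: "(\<And>\<alpha>. \<alpha> \<in> U \<Longrightarrow> gain X P \<alpha> \<le> c) \<Longrightarrow> ham X P \<le> c"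
  unfolding best_gain_def using zero_U by (intro cSUP_least) auto

text \<open>
  Lets the estimates be carried out with a real supremum, which coercivity makes bounded, although
  the Hamiltonian is an extended real one.
\<close>

lemma ereal_ham:
  assumes "X \<in> D"
  shows "(SUP \<alpha>\<in>U. ereal (gain X P \<alpha>)) = ereal (ham X P)"
proof (rule antisym)
  show "(SUP \<alpha>\<in>U. ereal (gain X P \<alpha>)) \<le> ereal (ham X P)"
    by (intro SUP_least) (simp add: gain_le_ham assms)
  show "ereal (ham X P) \<le> (SUP \<alpha>\<in>U. ereal (gain X P \<alpha>))"
  proof (cases "SUP \<alpha>\<in>U. ereal (gain X P \<alpha>)")
    case (real r)
    then have "gain X P \<alpha> \<le> r" if "\<alpha> \<in> U" for \<alpha>
      using SUP_upper[OF that, of "\<lambda>\<alpha>. ereal (gain X P \<alpha>)"] by simp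
    then show ?thesis using real by (simp add: ham_le)
  next
    case MInf
    then show ?thesis using SUP_upper[OF zero_U, of "\<lambda>\<alpha>. ereal (gain X P \<alpha>)"] by simp
  qed simp
qed

lemma ham_convex:
  assumes "X \<in> D" "t \<in> {0..1}"
  shows "ham X ((1 - t) *\<^sub>R P + t *\<^sub>R Q) \<le> (1 - t) * ham X P + t * ham X Q"
proof (rule ham_le)
  fix \<alpha> assume \<alpha>: "\<alpha> \<in> U"
  have "gain X ((1 - t) *\<^sub>R P + t *\<^sub>R Q) \<alpha> = (1 - t) * gain X P \<alpha> + t * gain X Q \<alpha>"
    by (simp add: running_gain_def inner_add_right algebra_simps)
  also have "\<dots> \<le> (1 - t) * ham X P + t * ham X Q"
    using assms by (intro add_mono mult_left_mono gain_le_ham \<alpha>) auto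
  finally show "gain X ((1 - t) *\<^sub>R P + t *\<^sub>R Q) \<alpha> \<le> (1 - t) * ham X P + t * ham X Q" .
qed

lemma ham_state_lipschitz:
  assumes X: "X \<in> D" and Y: "Y \<in> D"
  shows "ham Y P \<le> ham X P + (Cbar * norm P + C\<^sub>2) * norm (X - Y)"
proof (rule ham_le)
  fix \<alpha> assume \<alpha>: "\<alpha> \<in> U"
  have "inner (b Y \<alpha> - b X \<alpha>) P \<le> norm (b Y \<alpha> - b X \<alpha>) * norm P" by (rule norm_cauchy_schwarz)
  also have "\<dots> \<le> (Cbar * norm (X - Y)) * norm P"
    using drift_lipschitz[OF Y X \<alpha>] by (intro mult_right_mono) (auto simp: norm_minus_commute)
  finally have "gain Y P \<alpha> \<le> gain X P \<alpha> + (Cbar * norm P + C\<^sub>2) * norm (X - Y)"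
    using cost_lipschitz[OF X Y \<alpha>] by (simp add: running_gain_def inner_diff_left algebra_simps)
  then show "gain Y P \<alpha> \<le> ham X P + (Cbar * norm P + C\<^sub>2) * norm (X - Y)"
    using gain_le_ham[OF X \<alpha>, of P] by linarith
qed

text \<open>
  Unlike the dependence on the state, that on the momentum is not Lipschitz uniformly in the control.
  Coercivity repairs this: a control outside a large ball earns at most \<open>m\<close>, a lower bound for what
  the control \<open>0\<close> earns at any state and momentum in the ball, hence it cannot matter.
\<close>

lemma ham_momentum_lipschitz:
  "\<exists>\<Lambda>\<ge>0. \<forall>X\<in>D. \<forall>P Q. norm X \<le> R \<longrightarrow> norm P \<le> R \<longrightarrow> norm Q \<le> R \<longrightarrow>
     ham X P \<le> ham X Q + \<Lambda> * norm (P - Q)"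
proof -
  obtain K where K: "K \<ge> 0" "\<And>X \<alpha>. \<lbrakk>X \<in> D; \<alpha> \<in> U; norm X \<le> R\<rbrakk> \<Longrightarrow> norm (b X \<alpha>) \<le> K * (1 + norm \<alpha>)"
    using drift_growth by meson
  define m where "m = - (K * \<bar>R\<bar>) - C\<^sub>1 * (1 + R)"
  have m: "m \<le> ham X Q" if "X \<in> D" "norm X \<le> R" "norm Q \<le> R" for X Q
  proof -
    have "\<bar>inner (b X 0) Q\<bar> \<le> norm (b X 0) * norm Q" by (rule Cauchy_Schwarz_ineq2)
    also have "\<dots> \<le> K * \<bar>R\<bar>"
      using K(1) K(2)[OF that(1) zero_U that(2)] that(3) by (intro mult_mono) auto
    finally have "- (K * \<bar>R\<bar>) \<le> inner (b X 0) Q" by linarith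
    moreover have "L X 0 \<le> C\<^sub>1 * (1 + R)"
      using cost_at_0[OF that(1)] mult_left_mono[of "1 + norm X" "1 + R" C\<^sub>1] that(2) C1_pos
      by linarith
    ultimately have "m \<le> gain X Q 0" by (simp add: m_def running_gain_def)
    also have "\<dots> \<le> ham X Q" by (rule gain_le_ham[OF that(1) zero_U])
    finally show ?thesis .
  qed
  obtain M where M: "\<And>X P \<alpha>. \<lbrakk>X \<in> D; \<alpha> \<in> U; norm X \<le> R; norm P \<le> R; norm \<alpha> > M\<rbrakk> \<Longrightarrow> gain X P \<alpha> \<le> m"
    using gain_coercive[of R m] by meson
  obtain \<Lambda> where \<Lambda>: "\<Lambda> \<ge> 0" "\<And>X P Q \<alpha>. \<lbrakk>X \<in> D; \<alpha> \<in> U; norm X \<le> R; norm \<alpha> \<le> M\<rbrakk> \<Longrightarrow>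
      gain X P \<alpha> \<le> gain X Q \<alpha> + \<Lambda> * norm (P - Q)"
    using gain_le_of_small_control[of R M] by meson
  have "ham X P \<le> ham X Q + \<Lambda> * norm (P - Q)"
    if "X \<in> D" "norm X \<le> R" "norm P \<le> R" "norm Q \<le> R" for X P Q
  proof (rule ham_le)
    fix \<alpha> assume \<alpha>: "\<alpha> \<in> U"
    show "gain X P \<alpha> \<le> ham X Q + \<Lambda> * norm (P - Q)"
    proof (cases "norm \<alpha> > M")
      case True
      then have "gain X P \<alpha> \<le> ham X Q"
        using M[OF that(1) \<alpha> that(2,3)] m[OF that(1,2,4)] by linarith
      then show ?thesis using mult_nonneg_nonneg[OF \<Lambda>(1) norm_ge_zero[of "P - Q"]] by linarith
    next
      case False
      then show ?thesis
        using \<Lambda>(2)[OF that(1) \<alpha> that(2), of P Q] gain_le_ham[OF that(1) \<alpha>, of Q] by linarith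
    qed
  qed
  then show ?thesis using \<Lambda>(1) by blast
qed

lemma ham_uniformly_continuous:
  assumes S: "S \<subseteq> D \<times> UNIV" and "bounded S"
  shows "uniformly_continuous_on S (\<lambda>(X, P). ham X P)"
proof -
  obtain R where R: "\<And>z. z \<in> S \<Longrightarrow> norm z \<le> R" using assms(2) bounded_iff by blast
  obtain \<Lambda> where \<Lambda>: "\<Lambda> \<ge> 0" "\<And>X P Q. \<lbrakk>X \<in> D; norm X \<le> R; norm P \<le> R; norm Q \<le> R\<rbrakk> \<Longrightarrow>
      ham X P \<le> ham X Q + \<Lambda> * norm (P - Q)"
    using ham_momentum_lipschitz[of R] by meson
  define C where "C = Cbar * \<bar>R\<bar> + C\<^sub>2 + \<Lambda>"
  have C: "C \<ge> 0" using \<Lambda>(1) Cbar_pos C2_pos by (simp add: C_def)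
  have one_sided: "ham X P \<le> ham Y Q + C * dist (X, P) (Y, Q)"
    if z: "(X, P) \<in> S" "(Y, Q) \<in> S" for X P Y Q
  proof -
    have D: "X \<in> D" "Y \<in> D" using z S by auto
    have bd: "norm Y \<le> R" "norm P \<le> R" "norm Q \<le> R"
      using R[OF z(1)] R[OF z(2)] norm_fst_le[of Y Q] norm_snd_le[of P X] norm_snd_le[of Q Y]
      by linarith+
    have "norm (X - Y) \<le> dist (X, P) (Y, Q)" "norm (P - Q) \<le> dist (X, P) (Y, Q)"
      using dist_fst_le[of "(X, P)" "(Y, Q)"] dist_snd_le[of "(X, P)" "(Y, Q)"] by (auto simp: dist_norm)
    then have d: "(Cbar * norm P + C\<^sub>2) * norm (X - Y) \<le> (Cbar * \<bar>R\<bar> + C\<^sub>2) * dist (X, P) (Y, Q)"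
      "\<Lambda> * norm (P - Q) \<le> \<Lambda> * dist (X, P) (Y, Q)"
      using bd Cbar_pos C2_pos \<Lambda>(1) by (auto intro!: mult_mono add_mono mult_left_mono)
    have "ham X P \<le> ham Y P + (Cbar * norm P + C\<^sub>2) * norm (X - Y)"
      using ham_state_lipschitz[OF D(2,1), of P] by (simp add: norm_minus_commute)
    also have "\<dots> \<le> (ham Y Q + \<Lambda> * norm (P - Q)) + (Cbar * norm P + C\<^sub>2) * norm (X - Y)"
      using \<Lambda>(2)[OF D(2) bd] by simp
    also have "\<dots> \<le> ham Y Q + C * dist (X, P) (Y, Q)"
      using d by (simp add: C_def algebra_simps)
    finally show ?thesis .
  qed
  have "C-lipschitz_on S (\<lambda>(X, P). ham X P)"
  proof (rule lipschitz_onI)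
    fix z w assume zw: "z \<in> S" "w \<in> S"
    obtain X P Y Q where [simp]: "z = (X, P)" "w = (Y, Q)" by (cases z, cases w)
    show "dist (case z of (X, P) \<Rightarrow> ham X P) (case w of (X, P) \<Rightarrow> ham X P) \<le> C * dist z w"
      using one_sided[of X P Y Q] one_sided[of Y Q X P] zw by (simp add: dist_real_def dist_commute abs_le_iff)
  qed (rule C)
  then show ?thesis by (rule lipschitz_on_uniformly_continuous)
qed

text \<open>
  At momentum \<open>\<gamma> (X - Y)\<close> the Lipschitz bound in the state is \<open>Cbar \<gamma> r\<^sup>2 + C\<^sub>2 r\<close> with \<open>r = |X - Y|\<close>, and
  \<open>C\<^sub>2 r \<le> C\<^sub>2\<^sup>2 \<gamma> r\<^sup>2 / 2 + 1 / (2 \<gamma>)\<close>.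
\<close>

lemma ham_difference_le:
  assumes X: "X \<in> D" and Y: "Y \<in> D" and \<gamma>: "\<gamma> > 0"
  shows "ham Y (\<gamma> *\<^sub>R (X - Y)) - ham X (\<gamma> *\<^sub>R (X - Y))
      \<le> (2 * Cbar + C\<^sub>2\<^sup>2) / 2 * \<gamma> * (norm (X - Y))\<^sup>2 + 1 / (2 * \<gamma>)"
proof -
  define r where "r = norm (X - Y)"
  define P where "P = \<gamma> *\<^sub>R (X - Y)"
  have "norm P = \<gamma> * r" using \<gamma> by (simp add: P_def r_def)
  then have "ham Y P - ham X P \<le> Cbar * \<gamma> * r\<^sup>2 + C\<^sub>2 * r"
    using ham_state_lipschitz[OF X Y, of P] by (simp add: r_def power2_eq_square algebra_simps)
  moreover have "C\<^sub>2 * r \<le> C\<^sub>2\<^sup>2 / 2 * \<gamma> * r\<^sup>2 + 1 / (2 * \<gamma>)"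
  proof -
    have "0 \<le> (C\<^sub>2 * \<gamma> * r - 1)\<^sup>2 / (2 * \<gamma>)" using \<gamma> by simp
    also have "\<dots> = C\<^sub>2\<^sup>2 / 2 * \<gamma> * r\<^sup>2 + 1 / (2 * \<gamma>) - C\<^sub>2 * r"
      using \<gamma> by (simp add: power2_eq_square field_simps)
    finally show ?thesis by simp
  qed
  ultimately show ?thesis
    unfolding P_def[symmetric] r_def[symmetric] by (simp add: add_divide_distrib algebra_simps)
qed

end

section \<open>Comparing Hamiltonians along embeddings\<close>

locale tracial_control_problem =
  fixes W :: "wstar set" and \<eta> :: model
    and Adm :: "wstar \<Rightarrow> (ell2 ^ 'd::finite) set"
    and b :: "wstar \<Rightarrow> ell2 ^ 'd \<Rightarrow> ell2 ^ 'd \<Rightarrow> ell2 ^ 'd"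
    and L :: "wstar \<Rightarrow> ell2 ^ 'd \<Rightarrow> ell2 ^ 'd \<Rightarrow> real"
    and g :: "wstar \<Rightarrow> ell2 ^ 'd \<Rightarrow> real"
    and Cbar C\<^sub>1 C\<^sub>2 :: real
  assumes tracial: "\<And>A. A \<in> W \<Longrightarrow> tracial_wstar A"
    and models: "\<And>A. A \<in> W \<Longrightarrow> L2_model A (\<eta> A)"
    and controls: "controls_assumption W \<eta> Adm"
    and drift: "drift_assumption W \<eta> Adm b Cbar"
    and costs: "costs_assumption W \<eta> Adm L g C\<^sub>1 C\<^sub>2"
begin

abbreviation gain :: "wstar \<Rightarrow> ell2 ^ 'd \<Rightarrow> ell2 ^ 'd \<Rightarrow> ell2 ^ 'd \<Rightarrow> real" where
  "gain A \<equiv> running_gain (b A) (L A)"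

abbreviation ham :: "wstar \<Rightarrow> ell2 ^ 'd \<Rightarrow> ell2 ^ 'd \<Rightarrow> real" where
  "ham A \<equiv> best_gain (Adm A) (b A) (L A)"

lemma tracial_completion: "A \<in> W \<Longrightarrow> tracial_completion \<eta> A"
  by (simp add: tracial_completion_def tracial models)

lemma completed_embedding:
  "\<lbrakk>A \<in> W; B \<in> W; wstar_embedding A B \<iota>\<rbrakk> \<Longrightarrow> completed_embedding \<eta> A B \<iota>"
  by (simp add: completed_embedding_def completed_embedding_axioms_def tracial_completion)

text \<open>
  The uniform drift bound for controls in the unit ball follows from the modulus of continuity by
  comparison with \<open>b A 0 0\<close>.
\<close>

lemma control_system:
  assumes A: "A \<in> W"
  shows "control_system (L2d_sa \<eta> A) (Adm A) (b A) (L A) Cbar C\<^sub>1 C\<^sub>2"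
proof -
  have zero: "(0 :: ell2 ^ 'd) \<in> L2d_sa \<eta> A" "0 \<in> Adm A"
    using subspace_0[OF tracial_completion.subspace_L2d_sa[OF tracial_completion[OF A]]]
      controls A unfolding controls_assumption_def by blast+
  show ?thesis
  proof
    show "convex (Adm A)" "0 \<in> Adm A"
      using controls A unfolding controls_assumption_def by blast+
    show "Cbar > 0" using drift unfolding drift_assumption_def by blast
    show "C\<^sub>1 > 0" "C\<^sub>2 > 0" using costs unfolding costs_assumption_def by blast+
    fix X :: "ell2 ^ 'd" assume X: "X \<in> L2d_sa \<eta> A"
    have C1: "- C\<^sub>1 + 1 / C\<^sub>1 * (norm \<alpha>)\<^sup>2 \<le> L A X \<alpha> \<and> L A X \<alpha> \<le> C\<^sub>1 * (1 + norm X + (norm \<alpha>)\<^sup>2)"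
      if "\<alpha> \<in> Adm A" for \<alpha> :: "ell2 ^ 'd"
      using costs A X that unfolding costs_assumption_def by blast
    show "L A X 0 \<le> C\<^sub>1 * (1 + norm X)" using C1[OF zero(2)] by simp
    fix \<alpha> assume \<alpha>: "\<alpha> \<in> Adm A"
    show "- C\<^sub>1 + 1 / C\<^sub>1 * (norm \<alpha>)\<^sup>2 \<le> L A X \<alpha>" using C1[OF \<alpha>] by blast
    show "b A X ((1 - t) *\<^sub>R \<alpha> + t *\<^sub>R \<beta>) = (1 - t) *\<^sub>R b A X \<alpha> + t *\<^sub>R b A X \<beta>"
      if "\<beta> \<in> Adm A" "t \<in> {0..1}" for \<beta> t
      using drift A X \<alpha> that unfolding drift_assumption_def by blast
    fix Y :: "ell2 ^ 'd" assume Y: "Y \<in> L2d_sa \<eta> A"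
    show "norm (b A X \<alpha> - b A Y \<alpha>) \<le> Cbar * norm (X - Y)"
      using drift A X Y \<alpha> unfolding drift_assumption_def by blast
    show "\<bar>L A X \<alpha> - L A Y \<alpha>\<bar> \<le> C\<^sub>2 * norm (X - Y)"
      using costs A X Y \<alpha> unfolding costs_assumption_def by blast
  next
    fix R :: real
    define M where "M = max R 1"
    have "M > 0" by (simp add: M_def)
    then obtain \<omega> where \<omega>: "modulus_of_continuity \<omega>"
      and mod: "\<And>X Y \<alpha> \<beta>. \<lbrakk>X \<in> L2d_sa \<eta> A; Y \<in> L2d_sa \<eta> A; \<alpha> \<in> Adm A; \<beta> \<in> Adm A;
        norm X \<le> M; norm Y \<le> M; norm \<alpha> \<le> M; norm \<beta> \<le> M\<rbrakk> \<Longrightarrow>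
        (norm (b A X \<alpha> - b A Y \<beta>))\<^sup>2 \<le> \<omega> ((norm (X - Y))\<^sup>2 + (norm (\<alpha> - \<beta>))\<^sup>2)"
      using drift A unfolding drift_assumption_def by meson
    have "norm (b A X \<alpha>) \<le> norm (b A 0 0) + sqrt (\<omega> (M\<^sup>2 + 1))"
      if X: "X \<in> L2d_sa \<eta> A" "norm X \<le> R" and \<alpha>: "\<alpha> \<in> Adm A" "norm \<alpha> \<le> 1" for X \<alpha> :: "ell2 ^ 'd"
    proof -
      have le: "norm X \<le> M" "norm \<alpha> \<le> M" using X(2) \<alpha>(2) by (auto simp: M_def)
      have "(norm (b A X \<alpha> - b A 0 0))\<^sup>2 \<le> \<omega> ((norm X)\<^sup>2 + (norm \<alpha>)\<^sup>2)"
        using mod[OF X(1) zero(1) \<alpha>(1) zero(2)] le \<open>M > 0\<close> by simp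
      also have "\<dots> \<le> \<omega> (M\<^sup>2 + 1)"
      proof (rule mono_onD[of "{0..}" \<omega>])
        show "mono_on {0..} \<omega>" using \<omega> unfolding modulus_of_continuity_def by blast
        show "(norm X)\<^sup>2 + (norm \<alpha>)\<^sup>2 \<le> M\<^sup>2 + 1"
          using power_mono[OF le(1), of 2] power_mono[OF \<alpha>(2), of 2] by simp
      qed auto
      finally have "norm (b A X \<alpha> - b A 0 0) \<le> sqrt (\<omega> (M\<^sup>2 + 1))" by (rule real_le_rsqrt)
      then show ?thesis using norm_triangle_ineq2[of "b A X \<alpha>" "b A 0 0"] by linarith
    qed
    then show "\<exists>K. \<forall>X\<in>L2d_sa \<eta> A. \<forall>\<alpha>\<in>Adm A. norm X \<le> R \<longrightarrow> norm \<alpha> \<le> 1 \<longrightarrow> norm (b A X \<alpha>) \<le> K"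
      by blast
  qed
qed

lemma drift_in_L2d_sa: "\<lbrakk>A \<in> W; X \<in> L2d_sa \<eta> A; \<alpha> \<in> Adm A\<rbrakk> \<Longrightarrow> b A X \<alpha> \<in> L2d_sa \<eta> A"
  and drift_emb: "\<lbrakk>A \<in> W; B \<in> W; wstar_embedding A B \<iota>; X \<in> L2d_sa \<eta> A; \<alpha> \<in> Adm A\<rbrakk> \<Longrightarrow>
    emb_tuple \<eta> A B \<iota> (b A X \<alpha>) = b B (emb_tuple \<eta> A B \<iota> X) (emb_tuple \<eta> A B \<iota> \<alpha>)"
  and drift_cond_exp: "\<lbrakk>A \<in> W; B \<in> W; wstar_embedding A B \<iota>; X \<in> L2d_sa \<eta> A; \<beta> \<in> Adm B\<rbrakk> \<Longrightarrow>
    b A X (cond_exp \<eta> A B \<iota> \<beta>) = cond_exp \<eta> A B \<iota> (b B (emb_tuple \<eta> A B \<iota> X) \<beta>)"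
  using drift by (simp_all add: drift_assumption_def)

lemma cost_emb: "\<lbrakk>A \<in> W; B \<in> W; wstar_embedding A B \<iota>; X \<in> L2d_sa \<eta> A; \<alpha> \<in> Adm A\<rbrakk> \<Longrightarrow>
    L B (emb_tuple \<eta> A B \<iota> X) (emb_tuple \<eta> A B \<iota> \<alpha>) = L A X \<alpha>"
  and cost_cond_exp: "\<lbrakk>A \<in> W; B \<in> W; wstar_embedding A B \<iota>; X \<in> L2d_sa \<eta> A; \<beta> \<in> Adm B\<rbrakk> \<Longrightarrow>
    L A X (cond_exp \<eta> A B \<iota> \<beta>) \<le> L B (emb_tuple \<eta> A B \<iota> X) \<beta>"
  using costs by (simp_all add: costs_assumption_def tracial_wstar_function2_def)

text \<open>
  Projecting a control to the smaller algebra keeps \<open>\<langle>b, P\<rangle>\<close>, since \<open>\<langle>b, \<iota> P\<rangle> = \<langle>E b, P\<rangle>\<close> and \<open>E\<close> moves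
  inside the drift, while the cost does not increase.
\<close>

lemma gain_le_gain_cond_exp:
  assumes AB: "A \<in> W" "B \<in> W" "wstar_embedding A B \<iota>"
    and X: "X \<in> L2d_sa \<eta> A" and P: "P \<in> L2d_sa \<eta> A" and \<alpha>: "\<alpha> \<in> Adm B"
  shows "gain B (emb_tuple \<eta> A B \<iota> X) (emb_tuple \<eta> A B \<iota> P) \<alpha> \<le> gain A X P (cond_exp \<eta> A B \<iota> \<alpha>)"
proof -
  interpret completed_embedding \<eta> A B \<iota> using AB by (rule completed_embedding)
  have "b A X (E \<alpha>) = E (b B (emb X) \<alpha>)"
    by (rule drift_cond_exp[OF AB X \<alpha>])
  moreover have "L A X (E \<alpha>) \<le> L B (emb X) \<alpha>"
    by (rule cost_cond_exp[OF AB X \<alpha>])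
  moreover have "inner (emb P) (b B (emb X) \<alpha>) = inner P (E (b B (emb X) \<alpha>))"
    using P dom.L2d_sa_subset by (intro inner_cond_exp) auto
  ultimately show ?thesis by (simp add: running_gain_def inner_commute)
qed

text \<open>
  Again the adjoint relation, now with \<open>\<iota>\<close> moved inside the drift; the cost is invariant under \<open>\<iota>\<close>.
\<close>

lemma gain_cond_exp_momentum:
  assumes AB: "A \<in> W" "B \<in> W" "wstar_embedding A B \<iota>"
    and X: "X \<in> L2d_sa \<eta> A" and \<alpha>: "\<alpha> \<in> Adm A"
  shows "gain A X (cond_exp \<eta> A B \<iota> P) \<alpha> = gain B (emb_tuple \<eta> A B \<iota> X) P (emb_tuple \<eta> A B \<iota> \<alpha>)"
proof -
  interpret completed_embedding \<eta> A B \<iota> using AB by (rule completed_embedding)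
  have "emb (b A X \<alpha>) = b B (emb X) (emb \<alpha>)"
    by (rule drift_emb[OF AB X \<alpha>])
  moreover have "L B (emb X) (emb \<alpha>) = L A X \<alpha>"
    by (rule cost_emb[OF AB X \<alpha>])
  moreover have "b A X \<alpha> \<in> L2d_sa \<eta> A"
    by (rule drift_in_L2d_sa[OF AB(1) X \<alpha>])
  ultimately show ?thesis
    using inner_cond_exp[of "b A X \<alpha>" P] dom.L2d_sa_subset by (auto simp: running_gain_def)
qed

lemma emb_tuple_in_Adm:
  "\<lbrakk>A \<in> W; B \<in> W; wstar_embedding A B \<iota>; \<alpha> \<in> Adm A\<rbrakk> \<Longrightarrow> emb_tuple \<eta> A B \<iota> \<alpha> \<in> Adm B"
  and cond_exp_in_Adm:
  "\<lbrakk>A \<in> W; B \<in> W; wstar_embedding A B \<iota>; \<beta> \<in> Adm B\<rbrakk> \<Longrightarrow> cond_exp \<eta> A B \<iota> \<beta> \<in> Adm A"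
  using controls unfolding controls_assumption_def by blast+

lemma ham_emb_le:
  assumes AB: "A \<in> W" "B \<in> W" "wstar_embedding A B \<iota>"
    and X: "X \<in> L2d_sa \<eta> A" and P: "P \<in> L2d_sa \<eta> A"
  shows "ham B (emb_tuple \<eta> A B \<iota> X) (emb_tuple \<eta> A B \<iota> P) \<le> ham A X P"
proof (rule control_system.ham_le[OF control_system[OF AB(2)]])
  fix \<alpha> assume \<alpha>: "\<alpha> \<in> Adm B"
  note gain_le_gain_cond_exp[OF AB X P \<alpha>]
  also have "gain A X P (cond_exp \<eta> A B \<iota> \<alpha>) \<le> ham A X P"
    by (rule control_system.gain_le_ham[OF control_system[OF AB(1)] X cond_exp_in_Adm[OF AB \<alpha>]])
  finally show "gain B (emb_tuple \<eta> A B \<iota> X) (emb_tuple \<eta> A B \<iota> P) \<alpha> \<le> ham A X P" .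
qed

lemma ham_cond_exp_le:
  assumes AB: "A \<in> W" "B \<in> W" "wstar_embedding A B \<iota>" and X: "X \<in> L2d_sa \<eta> A"
  shows "ham A X (cond_exp \<eta> A B \<iota> P) \<le> ham B (emb_tuple \<eta> A B \<iota> X) P"
proof (rule control_system.ham_le[OF control_system[OF AB(1)]])
  interpret completed_embedding \<eta> A B \<iota> using AB by (rule completed_embedding)
  fix \<alpha> assume \<alpha>: "\<alpha> \<in> Adm A"
  show "gain A X (E P) \<alpha> \<le> ham B (emb X) P"
    unfolding gain_cond_exp_momentum[OF AB X \<alpha>]
    by (rule control_system.gain_le_ham[OF control_system[OF AB(2)] emb_sa[OF X] emb_tuple_in_Adm[OF AB \<alpha>]])
qed

lemma ham_emb_eq:
  assumes AB: "A \<in> W" "B \<in> W" "wstar_embedding A B \<iota>"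
    and X: "X \<in> L2d_sa \<eta> A" and P: "P \<in> L2d_sa \<eta> A"
  shows "ham B (emb_tuple \<eta> A B \<iota> X) (emb_tuple \<eta> A B \<iota> P) = ham A X P"
proof (rule antisym[OF ham_emb_le[OF AB X P]])
  interpret completed_embedding \<eta> A B \<iota> using AB by (rule completed_embedding)
  have "E (emb P) = P" using P dom.L2d_sa_subset by (intro cond_exp_emb) auto
  then show "ham A X P \<le> ham B (emb X) (emb P)"
    using ham_cond_exp_le[OF AB X, of "emb P"] by simp
qed

text \<open>
  Every term of the supremum over the algebras extending \<open>A\<close> equals \<open>ham A X P\<close>, and the identity
  embedding shows that there is at least one term.
\<close>

lemma hamiltonian_eq_ham:
  assumes A: "A \<in> W" and X: "X \<in> L2d_sa \<eta> A" and P: "P \<in> L2d_sa \<eta> A"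
  shows "hamiltonian W \<eta> Adm b L A X P = ereal (ham A X P)"
proof -
  interpret tracial_completion \<eta> A using A by (rule tracial_completion)
  let ?S = "\<lambda>B \<iota>. SUP \<alpha>\<in>Adm B. ereal (gain B (emb_tuple \<eta> A B \<iota> X) (emb_tuple \<eta> A B \<iota> P) \<alpha>)"
  have "hamiltonian W \<eta> Adm b L A X P
      = (SUP (B, \<iota>) \<in> {(B, \<iota>). B \<in> W \<and> wstar_embedding A B \<iota>}. ?S B \<iota>)"
    by (simp add: hamiltonian_def running_gain_def Re_cinner_tuple)
  also have "\<dots> = (SUP (B, \<iota>) \<in> {(B, \<iota>). B \<in> W \<and> wstar_embedding A B \<iota>}. ereal (ham A X P))"
  proof (rule SUP_cong[OF refl], clarify)
    fix B \<iota> assume B: "B \<in> W" "wstar_embedding A B \<iota>"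
    have "emb_tuple \<eta> A B \<iota> X \<in> L2d_sa \<eta> B"
      by (rule completed_embedding.emb_sa[OF completed_embedding[OF A B] X])
    then show "?S B \<iota> = ereal (ham A X P)"
      by (simp add: control_system.ereal_ham[OF control_system[OF B(1)]] ham_emb_eq[OF A B X P])
  qed
  also have "\<dots> = ereal (ham A X P)"
  proof -
    have "{(B, \<iota>). B \<in> W \<and> wstar_embedding A B \<iota>} \<noteq> {}" using A wstar_embedding_id by blast
    then show ?thesis by (simp add: case_prod_beta)
  qed
  finally show ?thesis .
qed

end

theorem lemma3p5:
  fixes W :: "wstar set" and \<eta> :: model
    and Adm :: "wstar \<Rightarrow> (ell2 ^ 'd::finite) set"
    and b :: "wstar \<Rightarrow> ell2 ^ 'd \<Rightarrow> ell2 ^ 'd \<Rightarrow> ell2 ^ 'd"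
    and L :: "wstar \<Rightarrow> ell2 ^ 'd \<Rightarrow> ell2 ^ 'd \<Rightarrow> real"
    and g :: "wstar \<Rightarrow> ell2 ^ 'd \<Rightarrow> real"
    and Cbar C\<^sub>1 C\<^sub>2 :: real
  defines "H \<equiv> hamiltonian W \<eta> Adm b L"
  assumes "wstar_representatives W"
    and "\<forall>A\<in>W. L2_model A (\<eta> A)"
    and "controls_assumption W \<eta> Adm"
    and "drift_assumption W \<eta> Adm b Cbar"
    and "costs_assumption W \<eta> Adm L g C\<^sub>1 C\<^sub>2"
  shows "(\<forall>A\<in>W. \<forall>X\<in>L2d_sa \<eta> A. \<forall>P\<in>L2d_sa \<eta> A.
            H A X P = (SUP \<alpha>\<in>Adm A. ereal (Re (cinner_tuple (b A X \<alpha>) P) - L A X \<alpha>)))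
       \<and> (tracial_wstar_function2 W \<eta> (L2d_sa \<eta>) H \<and> E_convex_snd W \<eta> H)
       \<and> ((\<forall>A\<in>W. (\<forall>X\<in>L2d_sa \<eta> A. \<forall>P\<in>L2d_sa \<eta> A. \<bar>H A X P\<bar> \<noteq> \<infinity>) \<and>
             (\<forall>S \<subseteq> L2d_sa \<eta> A \<times> L2d_sa \<eta> A. bounded S \<longrightarrow>
                uniformly_continuous_on S (\<lambda>(X, P). real_of_ereal (H A X P))))
          \<and> (\<forall>A\<in>W. \<forall>X\<in>L2d_sa \<eta> A. \<forall>Y\<in>L2d_sa \<eta> A. \<forall>\<gamma>>1.
                H A X (\<gamma> *\<^sub>R (X - Y)) - H A Y (\<gamma> *\<^sub>R (X - Y))
                \<ge> ereal (- ((2 * Cbar + C\<^sub>2\<^sup>2) / 2 * \<gamma> * (norm (X - Y))\<^sup>2 + 1 / (2 * \<gamma>)))))"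
proof -
  have "\<And>A. A \<in> W \<Longrightarrow> tracial_wstar A"
    using assms(2) unfolding wstar_representatives_def by blast
  then interpret tracial_control_problem W \<eta> Adm b L g Cbar C\<^sub>1 C\<^sub>2
    using assms(3-6) by unfold_locales auto
  have H: "H A X P = ereal (ham A X P)" if "A \<in> W" "X \<in> L2d_sa \<eta> A" "P \<in> L2d_sa \<eta> A" for A X P
    unfolding H_def using that by (rule hamiltonian_eq_ham)
  have subspace: "subspace (L2d_sa \<eta> A)" if "A \<in> W" for A
    by (rule tracial_completion.subspace_L2d_sa[OF tracial_completion[OF that]])
  have formula: "H A X P = (SUP \<alpha>\<in>Adm A. ereal (Re (cinner_tuple (b A X \<alpha>) P) - L A X \<alpha>))"
    if "A \<in> W" "X \<in> L2d_sa \<eta> A" "P \<in> L2d_sa \<eta> A" for A X P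
    using control_system.ereal_ham[OF control_system[OF that(1)] that(2), of P]
    by (simp add: H[OF that] running_gain_def Re_cinner_tuple)
  have function2: "tracial_wstar_function2 W \<eta> (L2d_sa \<eta>) H"
    unfolding tracial_wstar_function2_def
  proof (intro conjI ballI allI impI)
    fix A B \<iota> and X P :: "ell2 ^ 'd"
    assume A: "A \<in> W" and X: "X \<in> L2d_sa \<eta> A" and P: "P \<in> L2d_sa \<eta> A"
    show "H A X P \<noteq> -\<infinity>" by (simp add: H[OF A X P])
    assume B: "B \<in> W" "wstar_embedding A B \<iota>"
    note emb_sa = completed_embedding.emb_sa[OF completed_embedding[OF A B]]
    show "H A X P = H B (emb_tuple \<eta> A B \<iota> X) (emb_tuple \<eta> A B \<iota> P)"
      by (simp add: H A B X P emb_sa ham_emb_eq[OF A B])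
  qed
  have E_convex: "E_convex_snd W \<eta> H"
    unfolding E_convex_snd_def
  proof (intro conjI ballI allI impI)
    fix A and X P Q :: "ell2 ^ 'd" and t :: real
    assume A: "A \<in> W" and X: "X \<in> L2d_sa \<eta> A" and P: "P \<in> L2d_sa \<eta> A" and Q: "Q \<in> L2d_sa \<eta> A"
      and t: "t \<in> {0..1}"
    have "(1 - t) *\<^sub>R P + t *\<^sub>R Q \<in> L2d_sa \<eta> A"
      by (intro subspace_add subspace_scale subspace A P Q)
    then show "H A X ((1 - t) *\<^sub>R P + t *\<^sub>R Q) \<le> ereal (1 - t) * H A X P + ereal t * H A X Q"
      using control_system.ham_convex[OF control_system[OF A] X t, of P Q] by (simp add: H A X P Q)
  next
    fix A B \<iota> and X P :: "ell2 ^ 'd"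
    assume AB: "A \<in> W" "B \<in> W" "wstar_embedding A B \<iota>"
      and X: "X \<in> L2d_sa \<eta> A" and P: "P \<in> L2d_sa \<eta> B"
    interpret completed_embedding \<eta> A B \<iota> using AB by (rule completed_embedding)
    show "H A X (E P) \<le> H B (emb X) P"
      using ham_cond_exp_le[OF AB X, of P] by (simp add: H AB X P emb_sa cond_exp_sa)
  qed
  have continuity: "uniformly_continuous_on S (\<lambda>(X, P). real_of_ereal (H A X P))"
    if A: "A \<in> W" and S: "S \<subseteq> L2d_sa \<eta> A \<times> L2d_sa \<eta> A" "bounded S" for A S
  proof -
    have "uniformly_continuous_on S (\<lambda>(X, P). ham A X P)"
      using S by (intro control_system.ham_uniformly_continuous[OF control_system[OF A]]) auto
    moreover have "(case z of (X, P) \<Rightarrow> real_of_ereal (H A X P)) = (case z of (X, P) \<Rightarrow> ham A X P)"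
      if "z \<in> S" for z
      using that S(1) by (auto simp: H[OF A])
    ultimately show ?thesis unfolding uniformly_continuous_on_def by simp
  qed
  have estimate: "H A X (\<gamma> *\<^sub>R (X - Y)) - H A Y (\<gamma> *\<^sub>R (X - Y))
      \<ge> ereal (- ((2 * Cbar + C\<^sub>2\<^sup>2) / 2 * \<gamma> * (norm (X - Y))\<^sup>2 + 1 / (2 * \<gamma>)))"
    if A: "A \<in> W" and X: "X \<in> L2d_sa \<eta> A" and Y: "Y \<in> L2d_sa \<eta> A" and \<gamma>: "\<gamma> > 1" for A X Y \<gamma>
  proof -
    have P: "\<gamma> *\<^sub>R (X - Y) \<in> L2d_sa \<eta> A"
      by (intro subspace_scale subspace_diff subspace A X Y)
    show ?thesis
      using control_system.ham_difference_le[OF control_system[OF A] X Y, of \<gamma>] \<gamma>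
      by (simp add: H[OF A X P] H[OF A Y P])
  qed
  have finite: "\<bar>H A X P\<bar> \<noteq> \<infinity>" if "A \<in> W" "X \<in> L2d_sa \<eta> A" "P \<in> L2d_sa \<eta> A" for A X P
    by (simp add: H[OF that])
  show ?thesis
    by (intro conjI ballI allI impI formula function2 E_convex finite continuity estimate)
qed

end
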